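(* Let $\{(\mathbf{x}_\alpha,\mathbf{v}_\alpha,T_\alpha)\}_{\alpha=1}^n$ be a solution on $[0,\infty)$ of the thermodynamic Cucker-Smale system in a harmonic potential field given in the context, where the communication weights satisfy $\phi_{\alpha\beta}=\phi(|\mathbf{x}_\alpha-\mathbf{x}_\beta|)$, $\zeta_{\alpha\beta}=\zeta(|\mathbf{x}_\alpha-\mathbf{x}_\beta|)$ with $\phi,\zeta:[0,\infty)\to[0,\infty)$ Lipschitz continuous and non-increasing. Suppose there are constants $\delta>3$, $\varepsilon_0>0$ and $\varepsilon$ such that, with $\mathcal{X},\mathcal{V},\mathcal{T},T_m,T_M,A_1,A_2$ as defined in the context (and $A_1>0$), the initial data satisfy $$T_m\ge\delta\varepsilon_0,\qquad \mathcal{X}(0)\le\varepsilon_0,\qquad \mathcal{V}(0)\le\varepsilon_0,\qquad \varepsilon_0^2>\mathcal{T}^2(0)+\frac{A_2}{|A_1-\frac23\varepsilon|},$$ and the parameters satisfy $$0<\varepsilon\le\tfrac12,\qquad \varepsilon\neq\tfrac32A_1,\qquad \phi(3\sqrt2\,\varepsilon_0)>\max\left\{\frac{\varepsilon+\varepsilon\gamma}{\lambda},\ \frac{2(T_M+\varepsilon_0)\phi(0)}{(\delta-1)(T_m-\varepsilon_0)}\right\},$$ where $$\lambda:=\frac{\kappa_1}{2(T_M+\varepsilon_0)},\qquad \gamma:=\frac{3(\kappa_1\phi(0))^2}{(T_m-\varepsilon_0)^2}+1 .$$ Then the following assertions hold. (1) The temperature fluctuations are uniformly bounded, i.e. for every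 $\alpha=1,\dots,n$, $$\sup_{0\le t<\infty}|T_\alpha(t)-T^\infty(t)|\le\varepsilon_0,$$ so that the temperatures are uniformly bounded and bounded away from zero: $$0<T_m-\varepsilon_0\le T_\alpha(t)\le T_M+\varepsilon_0,\qquad t\in[0,\infty),\ \alpha=1,\dots,n.$$ (2) For all $t\in[0,\infty)$, $$\sum_{\alpha=1}^n\Big(|\mathbf{x}_\alpha(t)-\mathbf{x}_c(t)|^2+|\mathbf{v}_\alpha(t)-\mathbf{v}_c(t)|^2\Big)\le 4\sum_{\alpha=1}^n\Big(|\mathbf{x}_\alpha(0)-\mathbf{x}_c(0)|^2+|\mathbf{v}_\alpha(0)-\mathbf{v}_c(0)|^2\Big)e^{-\frac{2\varepsilon}{3}t},$$ $$\sum_{\alpha=1}^n|T_\alpha(t)-T^\infty(t)|^2\le\sum_{\alpha=1}^n|T_\alpha(0)-T^\infty(0)|^2e^{-A_1t}+\frac{A_2}{A_1-\frac23\varepsilon}\Big(e^{-\frac{2\varepsilon}{3}t}-e^{-A_1t}\Big).$$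
   Context: Let $n,d\ge1$ be integers and $\kappa_1,\kappa_2>0$ constants. The system for positions $\mathbf{x}_\alpha(t)\in\mathbb{R}^d$, velocities $\mathbf{v}_\alpha(t)\in\mathbb{R}^d$ and temperatures $T_\alpha(t)\in\mathbb{R}$ ($\alpha=1,\dots,n$) is $$\frac{d\mathbf{x}_\alpha}{dt}=\mathbf{v}_\alpha,\qquad \frac{d\mathbf{v}_\alpha}{dt}=\frac{\kappa_1}{n}\sum_{\beta=1}^n\phi_{\alpha\beta}\Big(\frac{\mathbf{v}_\beta-\mathbf{v}_c}{T_\beta}-\frac{\mathbf{v}_\alpha-\mathbf{v}_c}{T_\alpha}\Big)-\mathbf{x}_\alpha,$$ $$\frac{d}{dt}\Big(T_\alpha+\tfrac12|\mathbf{v}_\alpha|^2\Big)=\frac{\kappa_2}{n}\sum_{\beta=1}^n\zeta_{\alpha\beta}\Big(\frac1{T_\alpha}-\frac1{T_\beta}\Big)+\frac{\kappa_1}{n}\sum_{\beta=1}^n\phi_{\alpha\beta}\Big(\frac{\mathbf{v}_\beta-\mathbf{v}_c}{T_\beta}-\frac{\mathbf{v}_\alpha-\mathbf{v}_c}{T_\alpha}\Big)\cdot\mathbf{v}_c .$$ A solution is a family of continuously differentiable functions with nonvanishing $T_\alpha$ satisfying these equations. Notation: $$\mathbf{x}_c:=\frac1n\sum_\alpha\mathbf{x}_\alpha,\quad \mathbf{v}_c:=\frac1n\sum_\alpha\mathbf{v}_\alpha,\quad T_c:=\frac1n\sum_\alpha T_\alpha,$$ $$T^\infty(t):=-\tfrac12|\mathbf{v}_c(t)|^2+T_c(0)+\frac1{2n}\sum_\alpha|\mathbf{v}_\alpha(0)|^2,$$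 $$T_m:=-(|\mathbf{v}_c(0)|^2+|\mathbf{x}_c(0)|^2)+T_c(0)+\frac1{2n}\sum_\alpha|\mathbf{v}_\alpha(0)|^2,\qquad T_M:=T_c(0)+\frac1{2n}\sum_\alpha|\mathbf{v}_\alpha(0)|^2,$$ with $T_m,T_M$ assumed positive. Fluctuations: $\hat{\mathbf{x}}_\alpha:=\mathbf{x}_\alpha-\mathbf{x}_c$, $\hat{\mathbf{v}}_\alpha:=\mathbf{v}_\alpha-\mathbf{v}_c$, $\hat T_\alpha:=T_\alpha-T^\infty$, and $$\mathcal{X}:=\Big(\sum_\alpha|\hat{\mathbf{x}}_\alpha|^2\Big)^{1/2},\quad \mathcal{V}:=\Big(\sum_\alpha|\hat{\mathbf{v}}_\alpha|^2\Big)^{1/2},\quad \mathcal{T}:=\Big(\sum_\alpha|\hat T_\alpha|^2\Big)^{1/2},$$ $$|\mathcal{Z}(t)|^2:=\mathcal{X}(t)^2+\mathcal{V}(t)^2,\qquad |\mathbf{z}_c(0)|^2:=|\mathbf{v}_c(0)|^2+|\mathbf{x}_c(0)|^2 .$$ For given $\varepsilon_0>0$, $$A_1:=\frac{2\kappa_2\zeta(3\sqrt2\,\varepsilon_0)}{(T_M+\varepsilon_0)^2}-\frac{\kappa_1\phi(0)}{T_m-\varepsilon_0}-1-\frac{16\kappa_1\phi(0)}{(T_m-\varepsilon_0)^2}|\mathcal{Z}(0)|^2-2\sqrt2\,|\mathbf{z}_c(0)|,$$ $$A_2:=16\left(\frac{2\phi(0)\kappa_1}{T_m-\varepsilon_0}+\frac{\kappa_2\zeta(3\sqrt2\,\varepsilon_0)}{2n(T_M+\varepsilon_0)^2}+1\right)|\mathcal{Z}(0)|^4+4\sqrt2\,|\mathbf{z}_c(0)|\,|\mathcal{Z}(0)|^2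 ,$$ and it is a standing assumption that $A_1>0$. *)

theory Defs
  imports "HOL-Analysis.Analysis"
begin

text \<open>
  Particles are indexed by a finite type \<open>'n\<close>, so that \<open>n = CARD('n)\<close>, and the ambient space is
  \<open>real ^ 'd\<close>, so that \<open>d = CARD('d)\<close>. A configuration is a family of functions of time; only the
  times \<open>t \<ge> 0\<close> matter. Derivatives are taken within \<open>{0..}\<close>, that is, one-sided at \<open>t = 0\<close>.
\<close>

definition C1_on_nonneg :: "(real \<Rightarrow> 'b::real_normed_vector) \<Rightarrow> bool" where
  "C1_on_nonneg f \<longleftrightarrow>
     (\<exists>f'. (\<forall>t\<ge>0. (f has_vector_derivative f' t) (at t within {0..})) \<and> continuous_on {0..} f')"

definition center :: "('n::finite \<Rightarrow> real \<Rightarrow> 'b::real_vector) \<Rightarrow> real \<Rightarrow> 'b" where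
  "center f t = (1 / real CARD('n)) *\<^sub>R (\<Sum>\<alpha>\<in>UNIV. f \<alpha> t)"

definition coupling ::
  "real \<Rightarrow> (real \<Rightarrow> real) \<Rightarrow> ('n::finite \<Rightarrow> real \<Rightarrow> real ^ 'd) \<Rightarrow> ('n \<Rightarrow> real \<Rightarrow> real ^ 'd)
     \<Rightarrow> ('n \<Rightarrow> real \<Rightarrow> real) \<Rightarrow> 'n \<Rightarrow> real \<Rightarrow> real ^ 'd" where
  "coupling \<kappa>1 \<phi> x v T \<alpha> t =
     (\<kappa>1 / real CARD('n)) *\<^sub>R
       (\<Sum>\<beta>\<in>UNIV. \<phi> (norm (x \<alpha> t - x \<beta> t)) *\<^sub>R
          ((v \<beta> t - center v t) /\<^sub>R T \<beta> t - (v \<alpha> t - center v t) /\<^sub>R T \<alpha> t))"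

definition TCS_harmonic_solution ::
  "real \<Rightarrow> real \<Rightarrow> (real \<Rightarrow> real) \<Rightarrow> (real \<Rightarrow> real) \<Rightarrow> ('n::finite \<Rightarrow> real \<Rightarrow> real ^ 'd)
     \<Rightarrow> ('n \<Rightarrow> real \<Rightarrow> real ^ 'd) \<Rightarrow> ('n \<Rightarrow> real \<Rightarrow> real) \<Rightarrow> bool" where
  "TCS_harmonic_solution \<kappa>1 \<kappa>2 \<phi> \<zeta> x v T \<longleftrightarrow>
     (\<forall>\<alpha>. C1_on_nonneg (x \<alpha>) \<and> C1_on_nonneg (v \<alpha>) \<and> C1_on_nonneg (T \<alpha>)) \<and>
     (\<forall>\<alpha>. \<forall>t\<ge>0. T \<alpha> t \<noteq> 0) \<and>
     (\<forall>\<alpha>. \<forall>t\<ge>0. (x \<alpha> has_vector_derivative v \<alpha> t) (at t within {0..})) \<and>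
     (\<forall>\<alpha>. \<forall>t\<ge>0. (v \<alpha> has_vector_derivative (coupling \<kappa>1 \<phi> x v T \<alpha> t - x \<alpha> t)) (at t within {0..})) \<and>
     (\<forall>\<alpha>. \<forall>t\<ge>0. ((\<lambda>s. T \<alpha> s + 1/2 * (norm (v \<alpha> s))\<^sup>2) has_real_derivative
          (\<kappa>2 / real CARD('n) *
             (\<Sum>\<beta>\<in>UNIV. \<zeta> (norm (x \<alpha> t - x \<beta> t)) * (1 / T \<alpha> t - 1 / T \<beta> t))
           + coupling \<kappa>1 \<phi> x v T \<alpha> t \<bullet> center v t)) (at t within {0..}))"

definition T_M :: "('n::finite \<Rightarrow> real \<Rightarrow> real ^ 'd) \<Rightarrow> ('n \<Rightarrow> real \<Rightarrow> real) \<Rightarrow> real" where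
  "T_M v T = center T 0 + 1 / (2 * real CARD('n)) * (\<Sum>\<alpha>\<in>UNIV. (norm (v \<alpha> 0))\<^sup>2)"

definition T_m ::
  "('n::finite \<Rightarrow> real \<Rightarrow> real ^ 'd) \<Rightarrow> ('n \<Rightarrow> real \<Rightarrow> real ^ 'd) \<Rightarrow> ('n \<Rightarrow> real \<Rightarrow> real) \<Rightarrow> real" where
  "T_m x v T = - ((norm (center v 0))\<^sup>2 + (norm (center x 0))\<^sup>2)
     + center T 0 + 1 / (2 * real CARD('n)) * (\<Sum>\<alpha>\<in>UNIV. (norm (v \<alpha> 0))\<^sup>2)"

definition T_inf ::
  "('n::finite \<Rightarrow> real \<Rightarrow> real ^ 'd) \<Rightarrow> ('n \<Rightarrow> real \<Rightarrow> real) \<Rightarrow> real \<Rightarrow> real" where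
  "T_inf v T t = - (1/2) * (norm (center v t))\<^sup>2
     + center T 0 + 1 / (2 * real CARD('n)) * (\<Sum>\<alpha>\<in>UNIV. (norm (v \<alpha> 0))\<^sup>2)"

text \<open>The functions \<open>\<X>\<close> and \<open>\<V>\<close> are \<open>fluct x\<close> and \<open>fluct v\<close>; the function \<open>\<T>\<close> is
  \<open>temp_fluct v T\<close>, which measures deviation from \<open>T_inf\<close> and not from \<open>center T\<close>.\<close>

definition fluct :: "('n::finite \<Rightarrow> real \<Rightarrow> real ^ 'd) \<Rightarrow> real \<Rightarrow> real" where
  "fluct y t = sqrt (\<Sum>\<alpha>\<in>UNIV. (norm (y \<alpha> t - center y t))\<^sup>2)"

definition temp_fluct ::
  "('n::finite \<Rightarrow> real \<Rightarrow> real ^ 'd) \<Rightarrow> ('n \<Rightarrow> real \<Rightarrow> real) \<Rightarrow> real \<Rightarrow> real" where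
  "temp_fluct v T t = sqrt (\<Sum>\<alpha>\<in>UNIV. \<bar>T \<alpha> t - T_inf v T t\<bar>\<^sup>2)"

definition Z_norm ::
  "('n::finite \<Rightarrow> real \<Rightarrow> real ^ 'd) \<Rightarrow> ('n \<Rightarrow> real \<Rightarrow> real ^ 'd) \<Rightarrow> real \<Rightarrow> real" where
  "Z_norm x v t = sqrt ((fluct x t)\<^sup>2 + (fluct v t)\<^sup>2)"

definition zc_norm0 ::
  "('n::finite \<Rightarrow> real \<Rightarrow> real ^ 'd) \<Rightarrow> ('n \<Rightarrow> real \<Rightarrow> real ^ 'd) \<Rightarrow> real" where
  "zc_norm0 x v = sqrt ((norm (center v 0))\<^sup>2 + (norm (center x 0))\<^sup>2)"

definition A1 ::
  "real \<Rightarrow> real \<Rightarrow> (real \<Rightarrow> real) \<Rightarrow> (real \<Rightarrow> real) \<Rightarrow> real \<Rightarrow> ('n::finite \<Rightarrow> real \<Rightarrow> real ^ 'd)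
     \<Rightarrow> ('n \<Rightarrow> real \<Rightarrow> real ^ 'd) \<Rightarrow> ('n \<Rightarrow> real \<Rightarrow> real) \<Rightarrow> real" where
  "A1 \<kappa>1 \<kappa>2 \<phi> \<zeta> \<epsilon>0 x v T =
     2 * \<kappa>2 * \<zeta> (3 * sqrt 2 * \<epsilon>0) / (T_M v T + \<epsilon>0)\<^sup>2
     - \<kappa>1 * \<phi> 0 / (T_m x v T - \<epsilon>0)
     - 1
     - 16 * \<kappa>1 * \<phi> 0 / (T_m x v T - \<epsilon>0)\<^sup>2 * (Z_norm x v 0)\<^sup>2
     - 2 * sqrt 2 * zc_norm0 x v"

definition A2 ::
  "real \<Rightarrow> real \<Rightarrow> (real \<Rightarrow> real) \<Rightarrow> (real \<Rightarrow> real) \<Rightarrow> real \<Rightarrow> ('n::finite \<Rightarrow> real \<Rightarrow> real ^ 'd)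
     \<Rightarrow> ('n \<Rightarrow> real \<Rightarrow> real ^ 'd) \<Rightarrow> ('n \<Rightarrow> real \<Rightarrow> real) \<Rightarrow> real" where
  "A2 \<kappa>1 \<kappa>2 \<phi> \<zeta> \<epsilon>0 x v T =
     16 * (2 * \<phi> 0 * \<kappa>1 / (T_m x v T - \<epsilon>0)
           + \<kappa>2 * \<zeta> (3 * sqrt 2 * \<epsilon>0) / (2 * real CARD('n) * (T_M v T + \<epsilon>0)\<^sup>2)
           + 1) * (Z_norm x v 0) ^ 4
     + 4 * sqrt 2 * zc_norm0 x v * (Z_norm x v 0)\<^sup>2"

end

theory Submission
  imports Defs
begin

text \<open>
  Write \<open>dx\<close>, \<open>dv\<close> for the deviations of positions and velocities from their centres, \<open>dT\<close> for the
  deviation of the temperatures from \<open>T_inf\<close>, \<open>L\<close> and \<open>U\<close> for the claimed temperature bounds, and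
  \<open>X\<close>, \<open>V\<close>, \<open>H\<close> for the sums of squares of \<open>dx\<close>, \<open>dv\<close>, \<open>dT\<close>. The proof is a continuity argument.
  As long as a solution is \<^emph>\<open>confined\<close>, that is \<open>sqrt H \<le> \<epsilon>0\<close> and \<open>sqrt X \<le> 3 * \<epsilon>0\<close>, all temperatures
  lie between \<open>L\<close> and \<open>U\<close> and all distances are at most \<open>3 * sqrt 2 * \<epsilon>0\<close>, so the monotone weights
  are bounded below. Two estimates then hold, and together they improve the confinement to a strict
  one; hence the solution never leaves the confined region (\<open>confined_always\<close>), and both estimates
  hold for all times.

  The first estimate is hypocoercive. Since the couplings cancel in pairs, the centres perform a free
  harmonic oscillation of constant energy and drop out of the equations for \<open>dx\<close>, \<open>dv\<close>. The energy
  \<open>(X + V) / 2\<close> is dissipated only through \<open>V\<close> (\<open>alignment_dissipation\<close>), but the derivative of the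
  cross term \<open>\<epsilon> * (\<Sum> dx \<bullet> dv)\<close> contributes \<open>- \<epsilon> * X\<close> because of the harmonic force. The sum of the two
  is a Lyapunov functional comparable to \<open>X + V\<close>, which gives decay of \<open>X + V\<close> at rate \<open>2 * \<epsilon> / 3\<close>
  (\<open>flocking_decay\<close>). In particular \<open>X < (3 * \<epsilon>0)\<^sup>2\<close>.

  The second estimate is for \<open>H\<close>. Heat exchange damps the temperature differences
  (\<open>temperature_relaxation\<close>). The mean of \<open>dT\<close> is not damped, but conservation of energy makes
  the sum of \<open>dT\<close> equal to \<open>- V / 2\<close>, which already decays. The remaining terms, heating by friction
  (\<open>collisional_heating\<close>) and the work of the harmonic force, are split by Young's inequality into a
  part absorbed in the damping and a part of order \<open>(X + V)\<^sup>2\<close> or \<open>X + V\<close>, which decays. The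
  outcome is \<open>H' \<le> - A1 * H + A2 * exp (- (2 * \<epsilon> / 3) * t)\<close> (\<open>\<T>_differential_inequality\<close>), and
  integrating it gives the bound on \<open>H\<close> and, by the smallness of the data, \<open>H < \<epsilon>0\<^sup>2\<close>.
\<close>

section \<open>Pairwise interaction sums over finitely many particles\<close>

lemma sum_sum_norm_diff_squared:
  fixes y :: "'n::finite \<Rightarrow> 'a::real_inner"
  shows "(\<Sum>a\<in>UNIV. \<Sum>b\<in>UNIV. (norm (y a - y b))\<^sup>2)
    = 2 * real CARD('n) * (\<Sum>a\<in>UNIV. (norm (y a))\<^sup>2) - 2 * (norm (\<Sum>a\<in>UNIV. y a))\<^sup>2"
proof -
  have "(\<Sum>a\<in>UNIV. \<Sum>b\<in>UNIV. (norm (y a - y b))\<^sup>2)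
      = (\<Sum>a\<in>UNIV. \<Sum>b\<in>UNIV. (norm (y a))\<^sup>2 + (norm (y b))\<^sup>2 - 2 * (y a \<bullet> y b))"
    by (simp add: power2_norm_eq_inner algebra_simps inner_commute)
  also have "\<dots> = 2 * real CARD('n) * (\<Sum>a\<in>UNIV. (norm (y a))\<^sup>2)
      - 2 * ((\<Sum>a\<in>UNIV. y a) \<bullet> (\<Sum>b\<in>UNIV. y b))"
    by (simp add: sum.distrib sum_subtractf inner_sum_left inner_sum_right mult.assoc
        inner_commute flip: sum_distrib_left)
  finally show ?thesis by (simp add: power2_norm_eq_inner)
qed

lemma sum_sum_antisymmetric:
  fixes g :: "'n::finite \<Rightarrow> 'n \<Rightarrow> 'a::real_vector"
  assumes "\<And>a b. g b a = - g a b"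
  shows "(\<Sum>a\<in>UNIV. \<Sum>b\<in>UNIV. g a b) = 0"
proof -
  let ?S = "\<Sum>a\<in>UNIV. \<Sum>b\<in>UNIV. g a b"
  have "?S = (\<Sum>a\<in>UNIV. \<Sum>b\<in>UNIV. g b a)" by (rule sum.swap)
  also have "\<dots> = (\<Sum>a\<in>UNIV. \<Sum>b\<in>UNIV. - g a b)" by (intro sum.cong refl assms)
  also have "\<dots> = - ?S" by (simp add: sum_negf)
  finally have "2 *\<^sub>R ?S = 0" by (metis add.right_inverse scaleR_2)
  then show ?thesis by simp
qed

text \<open>
  Exchanging the roles of the two particles turns the work done by pairwise antisymmetric forces into
  a sum over differences, where signs become visible.
\<close>

lemma sum_sum_symmetrize:
  fixes s :: "'n::finite \<Rightarrow> 'n \<Rightarrow> real" and y w :: "'n \<Rightarrow> 'a::real_inner"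
  assumes sym: "\<And>a b. s a b = s b a"
  shows "2 * (\<Sum>a\<in>UNIV. \<Sum>b\<in>UNIV. s a b * (y a \<bullet> (w b - w a)))
    = - (\<Sum>a\<in>UNIV. \<Sum>b\<in>UNIV. s a b * ((y a - y b) \<bullet> (w a - w b)))"
proof -
  let ?S = "\<Sum>a\<in>UNIV. \<Sum>b\<in>UNIV. s a b * (y a \<bullet> (w b - w a))"
  have "?S = (\<Sum>a\<in>UNIV. \<Sum>b\<in>UNIV. s b a * (y b \<bullet> (w a - w b)))" by (rule sum.swap)
  then have "2 * ?S = (\<Sum>a\<in>UNIV. \<Sum>b\<in>UNIV. s a b * (y a \<bullet> (w b - w a)) + s b a * (y b \<bullet> (w a - w b)))"
    by (simp add: sum.distrib)
  also have "\<dots> = (\<Sum>a\<in>UNIV. \<Sum>b\<in>UNIV. - (s a b * ((y a - y b) \<bullet> (w a - w b))))"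
    by (intro sum.cong refl, subst sym) (simp add: algebra_simps)
  finally show ?thesis by (simp add: sum_negf)
qed

text \<open>
  If all \<open>\<theta>\<close> are equal, the forces \<open>u b / \<theta> b - u a / \<theta> a\<close> damp velocity differences. For unequal \<open>\<theta>\<close>
  the bilinear form is no longer symmetric; polarization
  \<open>(u a - u b) \<bullet> (u a / \<theta> a - u b / \<theta> b) = (1 / \<theta> a + 1 / \<theta> b) / 2 * |u a - u b|\<^sup>2 + (1 / \<theta> a - 1 / \<theta> b) / 2 * (|u a|\<^sup>2 - |u b|\<^sup>2)\<close>
  isolates the defect, whose size is controlled by \<open>K\<close>. The first term controls all of
  \<open>\<Sum> |u a|\<^sup>2\<close> because the \<open>u a\<close> sum to zero.
\<close>

lemma coupling_dissipation:
  fixes s :: "'n::finite \<Rightarrow> 'n \<Rightarrow> real" and u :: "'n \<Rightarrow> 'a::real_inner" and \<theta> :: "'n \<Rightarrow> real"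
  assumes sym: "\<And>a b. s a b = s b a" and s: "\<And>a b. p \<le> s a b" "\<And>a b. s a b \<le> P" and "0 \<le> p"
    and \<theta>: "\<And>a. 0 < \<theta> a" "\<And>a. \<theta> a \<le> U"
    and K: "\<And>a b. \<bar>1 / \<theta> a - 1 / \<theta> b\<bar> \<le> K"
    and u0: "(\<Sum>a\<in>UNIV. u a) = 0"
  shows "(\<Sum>a\<in>UNIV. \<Sum>b\<in>UNIV. s a b * (u a \<bullet> (u b /\<^sub>R \<theta> b - u a /\<^sub>R \<theta> a)))
    \<le> real CARD('n) * (P * K / 2 - p / U) * (\<Sum>a\<in>UNIV. (norm (u a))\<^sup>2)"
proof -
  let ?W = "\<Sum>a\<in>UNIV. (norm (u a))\<^sup>2" and ?n = "real CARD('n)"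
  have pair: "p / U * (norm (u a - u b))\<^sup>2 - P * K / 2 * ((norm (u a))\<^sup>2 + (norm (u b))\<^sup>2)
      \<le> s a b * ((u a - u b) \<bullet> (u a /\<^sub>R \<theta> a - u b /\<^sub>R \<theta> b))" for a b
  proof -
    define N where "N = (norm (u a - u b))\<^sup>2"
    define M where "M = (norm (u a))\<^sup>2 - (norm (u b))\<^sup>2"
    have eq: "(u a - u b) \<bullet> (u a /\<^sub>R \<theta> a - u b /\<^sub>R \<theta> b)
        = (1 / \<theta> a + 1 / \<theta> b) / 2 * N + (1 / \<theta> a - 1 / \<theta> b) / 2 * M"
      unfolding N_def M_def power2_norm_eq_inner
      by (simp add: inner_commute algebra_simps inverse_eq_divide add_divide_distrib diff_divide_distrib)
    have "1 / U \<le> 1 / \<theta> a" "1 / U \<le> 1 / \<theta> b" using \<theta> by (simp_all add: frac_le)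
    then have "p * (1 / U) * N \<le> s a b * ((1 / \<theta> a + 1 / \<theta> b) / 2) * N"
      using s(1)[of a b] \<open>0 \<le> p\<close> order.strict_trans2[OF \<theta>(1)[of a] \<theta>(2)[of a]]
      by (intro mult_right_mono mult_mono) (auto simp: N_def)
    moreover have "\<bar>s a b * ((1 / \<theta> a - 1 / \<theta> b) / 2 * M)\<bar>
        \<le> P * (K / 2 * ((norm (u a))\<^sup>2 + (norm (u b))\<^sup>2))"
      unfolding abs_mult
      using s[of a b] \<open>0 \<le> p\<close> K[of a b]
      by (intro mult_mono) (auto simp: M_def abs_le_iff)
    moreover have "s a b * ((1 / \<theta> a + 1 / \<theta> b) / 2 * N + (1 / \<theta> a - 1 / \<theta> b) / 2 * M)
        = s a b * ((1 / \<theta> a + 1 / \<theta> b) / 2) * N + s a b * ((1 / \<theta> a - 1 / \<theta> b) / 2 * M)"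
      by (simp only: distrib_left mult.assoc)
    moreover have "p / U * N - P * K / 2 * ((norm (u a))\<^sup>2 + (norm (u b))\<^sup>2)
        = p * (1 / U) * N - P * (K / 2 * ((norm (u a))\<^sup>2 + (norm (u b))\<^sup>2))"
      by simp
    ultimately show ?thesis
      unfolding eq N_def[symmetric]
      by (metis (no_types, lifting) abs_le_D2 add_mono diff_conv_add_uminus minus_le_iff)
  qed
  have "p / U * (2 * ?n * ?W) - P * K / 2 * (2 * ?n * ?W)
      = (\<Sum>a\<in>UNIV. \<Sum>b\<in>UNIV. p / U * (norm (u a - u b))\<^sup>2
          - P * K / 2 * ((norm (u a))\<^sup>2 + (norm (u b))\<^sup>2))"
    by (simp only: sum_subtractf sum.distrib sum_constant sum_sum_norm_diff_squared u0
        flip: sum_distrib_left) simp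
  also have "\<dots> \<le> (\<Sum>a\<in>UNIV. \<Sum>b\<in>UNIV. s a b * ((u a - u b) \<bullet> (u a /\<^sub>R \<theta> a - u b /\<^sub>R \<theta> b)))"
    by (intro sum_mono pair)
  also have "\<dots> = - 2 * (\<Sum>a\<in>UNIV. \<Sum>b\<in>UNIV. s a b * (u a \<bullet> (u b /\<^sub>R \<theta> b - u a /\<^sub>R \<theta> a)))"
    using sum_sum_symmetrize[where y = u and w = "\<lambda>a. u a /\<^sub>R \<theta> a", OF sym] by simp
  finally show ?thesis by (simp add: algebra_simps)
qed

text \<open>
  By the Cauchy-Schwarz inequality over the \<open>n\<close> partners, the total force is bounded by the pairwise
  differences of \<open>w\<close>, and these sum to at most \<open>2 * n * \<Sum> |w a|\<^sup>2\<close>.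
\<close>

lemma coupling_norm_bound:
  fixes s :: "'n::finite \<Rightarrow> 'n \<Rightarrow> real" and w :: "'n \<Rightarrow> 'a::real_inner"
  assumes s: "\<And>a b. 0 \<le> s a b" "\<And>a b. s a b \<le> P"
  shows "(\<Sum>a\<in>UNIV. (norm (\<Sum>b\<in>UNIV. s a b *\<^sub>R (w b - w a)))\<^sup>2)
    \<le> 2 * (real CARD('n) * P)\<^sup>2 * (\<Sum>a\<in>UNIV. (norm (w a))\<^sup>2)"
proof -
  let ?n = "real CARD('n)"
  have P: "0 \<le> P" using s order_trans by blast
  have each: "(norm (\<Sum>b\<in>UNIV. s a b *\<^sub>R (w b - w a)))\<^sup>2
      \<le> ?n * P\<^sup>2 * (\<Sum>b\<in>UNIV. (norm (w a - w b))\<^sup>2)" for a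
  proof -
    have "norm (\<Sum>b\<in>UNIV. s a b *\<^sub>R (w b - w a)) \<le> (\<Sum>b\<in>UNIV. P * norm (w a - w b))"
      by (rule order_trans[OF norm_sum], rule sum_mono)
        (use s in \<open>auto simp: norm_minus_commute intro!: mult_right_mono\<close>)
    then have "(norm (\<Sum>b\<in>UNIV. s a b *\<^sub>R (w b - w a)))\<^sup>2 \<le> (\<Sum>b\<in>UNIV. P * norm (w a - w b))\<^sup>2"
      by (intro power_mono) auto
    also have "\<dots> \<le> (\<Sum>b\<in>UNIV. (P * norm (w a - w b))\<^sup>2) * ?n"
      by (rule sum_squared_le_sum_of_squares)
    finally show ?thesis by (simp add: power_mult_distrib mult_ac flip: sum_distrib_left)
  qed
  have "(\<Sum>a\<in>UNIV. (norm (\<Sum>b\<in>UNIV. s a b *\<^sub>R (w b - w a)))\<^sup>2)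
      \<le> (\<Sum>a\<in>UNIV. ?n * P\<^sup>2 * (\<Sum>b\<in>UNIV. (norm (w a - w b))\<^sup>2))"
    by (intro sum_mono each)
  also have "\<dots> = ?n * P\<^sup>2 * (\<Sum>a\<in>UNIV. \<Sum>b\<in>UNIV. (norm (w a - w b))\<^sup>2)"
    by (rule sum_distrib_left[symmetric])
  also have "\<dots> \<le> ?n * P\<^sup>2 * (2 * ?n * (\<Sum>a\<in>UNIV. (norm (w a))\<^sup>2))"
    by (intro mult_left_mono) (auto simp: sum_sum_norm_diff_squared)
  finally show ?thesis by (simp add: power2_eq_square mult_ac)
qed

text \<open>
  Heat flows from hot to cold: symmetrized, each pair contributes \<open>- (h a - h b)\<^sup>2 / (\<theta> a * \<theta> b)\<close>. Only
  differences are damped, so the square of the sum of \<open>h\<close> has to be subtracted.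
\<close>

lemma temperature_relaxation:
  fixes z :: "'n::finite \<Rightarrow> 'n \<Rightarrow> real" and h :: "'n \<Rightarrow> real"
  assumes sym: "\<And>a b. z a b = z b a" and z: "\<And>a b. q \<le> z a b" and "0 \<le> q"
    and \<theta>: "\<And>a. 0 < c + h a" "\<And>a. c + h a \<le> U"
  shows "(\<Sum>a\<in>UNIV. \<Sum>b\<in>UNIV. z a b * (h a * (1 / (c + h a) - 1 / (c + h b))))
    \<le> - q / U\<^sup>2 * (real CARD('n) * (\<Sum>a\<in>UNIV. (h a)\<^sup>2) - (\<Sum>a\<in>UNIV. h a)\<^sup>2)"
proof -
  let ?\<theta> = "\<lambda>a. c + h a"
  have pair: "q / U\<^sup>2 * (norm (h a - h b))\<^sup>2 \<le> z a b * ((h a - h b) \<bullet> (- 1 / ?\<theta> a - - 1 / ?\<theta> b))" for a b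
  proof -
    have "(h a - h b) \<bullet> (- 1 / ?\<theta> a - - 1 / ?\<theta> b) = (norm (h a - h b))\<^sup>2 * (1 / (?\<theta> a * ?\<theta> b))"
      using \<theta>(1)[of a] \<theta>(1)[of b] by (simp add: field_simps power2_eq_square)
    moreover have "1 / U\<^sup>2 \<le> 1 / (?\<theta> a * ?\<theta> b)"
      unfolding power2_eq_square using \<theta>[of a] \<theta>[of b] by (intro divide_left_mono mult_mono) auto
    then have "q * (1 / U\<^sup>2 * (norm (h a - h b))\<^sup>2) \<le> z a b * ((norm (h a - h b))\<^sup>2 * (1 / (?\<theta> a * ?\<theta> b)))"
      using z[of a b] \<open>0 \<le> q\<close> less_imp_le[OF mult_pos_pos[OF \<theta>(1)[of a] \<theta>(1)[of b]]]
      by (subst mult.commute[of "(norm _)\<^sup>2"], intro mult_mono) auto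
    ultimately show ?thesis by simp
  qed
  have "q / U\<^sup>2 * (2 * real CARD('n) * (\<Sum>a\<in>UNIV. (h a)\<^sup>2) - 2 * (\<Sum>a\<in>UNIV. h a)\<^sup>2)
      = (\<Sum>a\<in>UNIV. \<Sum>b\<in>UNIV. q / U\<^sup>2 * (norm (h a - h b))\<^sup>2)"
    unfolding sum_distrib_left[symmetric] using sum_sum_norm_diff_squared[of h] by simp
  also have "\<dots> \<le> (\<Sum>a\<in>UNIV. \<Sum>b\<in>UNIV. z a b * ((h a - h b) \<bullet> (- 1 / ?\<theta> a - - 1 / ?\<theta> b)))"
    by (intro sum_mono pair)
  also have "\<dots> = - 2 * (\<Sum>a\<in>UNIV. \<Sum>b\<in>UNIV. z a b * (h a * (1 / ?\<theta> a - 1 / ?\<theta> b)))"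
    using sum_sum_symmetrize[where y = h and w = "\<lambda>a. - 1 / ?\<theta> a", OF sym] by simp
  finally have "2 * (\<Sum>a\<in>UNIV. \<Sum>b\<in>UNIV. z a b * (h a * (1 / ?\<theta> a - 1 / ?\<theta> b)))
      \<le> 2 * (- q / U\<^sup>2 * (real CARD('n) * (\<Sum>a\<in>UNIV. (h a)\<^sup>2) - (\<Sum>a\<in>UNIV. h a)\<^sup>2))"
    by (simp only: right_diff_distrib minus_divide_left[symmetric])
  then show ?thesis by simp
qed

text \<open>
  The obstacle is that the friction term is quadratic in \<open>u\<close> and only linear in \<open>h\<close>. Writing
  \<open>1 / (c + h a) = 1 / c - h a / ((c + h a) * c)\<close> separates the contribution of a uniform temperature
  \<open>c\<close>, which Young's inequality splits into \<open>H\<close> and \<open>W\<^sup>2\<close>, from a correction that is quadratic in \<open>h\<close>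
  and hence bounded by a multiple of \<open>W * H\<close>. In the correction the diagonal part has a favourable
  sign and is dropped.
\<close>

lemma collisional_heating:
  fixes s :: "'n::finite \<Rightarrow> 'n \<Rightarrow> real" and u :: "'n \<Rightarrow> 'a::real_inner" and h :: "'n \<Rightarrow> real"
  assumes s: "\<And>a b. 0 \<le> s a b" "\<And>a b. s a b \<le> P"
    and L: "0 < L" "\<And>a. L \<le> c + h a" "L \<le> c"
    and u0: "(\<Sum>a\<in>UNIV. u a) = 0"
  defines "H \<equiv> \<Sum>a\<in>UNIV. (h a)\<^sup>2" and "W \<equiv> \<Sum>a\<in>UNIV. (norm (u a))\<^sup>2"
  shows "2 * (\<Sum>a\<in>UNIV. \<Sum>b\<in>UNIV. s a b * (h a * (u a \<bullet> (u a /\<^sub>R (c + h a) - u b /\<^sub>R (c + h b)))))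
    \<le> real CARD('n) * (P / L * (H + 2 * W\<^sup>2) + 2 * P / L\<^sup>2 * (W * H))"
proof -
  let ?\<theta> = "\<lambda>a. c + h a" and ?n = "real CARD('n)"
  have P: "0 \<le> P" using s order_trans by blast
  have c: "0 < c" and \<theta>: "0 < ?\<theta> a" for a using L(1) L(2)[of a] L(3) by auto
  have n1: "1 \<le> ?n" by (simp add: Suc_le_eq)
  have W0: "0 \<le> W" unfolding W_def by (auto intro: sum_nonneg)
  have pair: "2 * (s a b * (h a * (u a \<bullet> (u a /\<^sub>R ?\<theta> a - u b /\<^sub>R ?\<theta> b))))
      \<le> P / L * ((h a)\<^sup>2 + (norm (u a))\<^sup>2 * (norm (u a - u b))\<^sup>2)
        + P / L\<^sup>2 * ((h a)\<^sup>2 * (norm (u a))\<^sup>2 + (h b)\<^sup>2 * (norm (u b))\<^sup>2)" for a b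
  proof -
    (* Inserting this for both inverses leaves a uniform-temperature part, a mixed part in h a * h b,
       and a part with negative sign. *)
    have split: "inverse (?\<theta> a) = 1 / c - h a / ?\<theta> a / c" for a
    proof -
      have "1 - h a / ?\<theta> a = c * inverse (?\<theta> a)"
        using \<theta>[of a] by (simp add: field_simps)
      then have "(1 - h a / ?\<theta> a) / c = inverse (?\<theta> a)" using c by simp
      then show ?thesis by (simp add: diff_divide_distrib)
    qed
    have eq: "2 * (h a * (u a \<bullet> (u a /\<^sub>R ?\<theta> a - u b /\<^sub>R ?\<theta> b)))
      = 1 / c * (2 * (h a * (u a \<bullet> (u a - u b))))
        + 1 / c * (1 / ?\<theta> b) * (2 * (h a * h b * (u a \<bullet> u b)))
        - 2 * (1 / c * (1 / ?\<theta> a)) * ((h a)\<^sup>2 * (norm (u a))\<^sup>2)"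
      unfolding split inner_diff_right inner_scaleR_right power2_norm_eq_inner
      by (simp add: algebra_simps power2_eq_square)
    have y1: "2 * (h a * (u a \<bullet> (u a - u b))) \<le> (h a)\<^sup>2 + (norm (u a))\<^sup>2 * (norm (u a - u b))\<^sup>2" (is "_ \<le> ?Y1")
    proof -
      have "2 * (h a * (u a \<bullet> (u a - u b))) \<le> (h a)\<^sup>2 + (u a \<bullet> (u a - u b))\<^sup>2"
        using sum_squares_bound[of "h a" "u a \<bullet> (u a - u b)"] by simp
      also have "(u a \<bullet> (u a - u b))\<^sup>2 \<le> (norm (u a))\<^sup>2 * (norm (u a - u b))\<^sup>2"
        using Cauchy_Schwarz_ineq[of "u a" "u a - u b"] by (simp add: power2_norm_eq_inner)
      finally show ?thesis by simp
    qed
    have y2: "2 * (h a * h b * (u a \<bullet> u b)) \<le> (h a)\<^sup>2 * (norm (u a))\<^sup>2 + (h b)\<^sup>2 * (norm (u b))\<^sup>2" (is "_ \<le> ?Y2")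
    proof -
      have "(norm (h a *\<^sub>R u a - h b *\<^sub>R u b))\<^sup>2 = ?Y2 - 2 * (h a * h b * (u a \<bullet> u b))"
        unfolding power2_norm_eq_inner by (simp add: algebra_simps inner_commute power2_eq_square)
      then show ?thesis using zero_le_power2[of "norm (h a *\<^sub>R u a - h b *\<^sub>R u b)"] by linarith
    qed
    have c1: "1 / c \<le> 1 / L" "1 / ?\<theta> b \<le> 1 / L" using L by (auto intro!: divide_left_mono mult_pos_pos c \<theta>)
    have "1 / c * (2 * (h a * (u a \<bullet> (u a - u b)))) \<le> 1 / L * ?Y1"
      using y1 c c1 L by (meson dual_order.trans mult_left_mono mult_right_mono zero_le_divide_1_iff less_imp_le
          add_nonneg_nonneg mult_nonneg_nonneg zero_le_power2)
    moreover have "1 / c * (1 / ?\<theta> b) * (2 * (h a * h b * (u a \<bullet> u b))) \<le> 1 / L * (1 / L) * ?Y2"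
    proof -
      have "1 / c * (1 / ?\<theta> b) * (2 * (h a * h b * (u a \<bullet> u b))) \<le> 1 / c * (1 / ?\<theta> b) * ?Y2"
        using y2 c \<theta>[of b] by (intro mult_left_mono) auto
      also have "\<dots> \<le> 1 / L * (1 / L) * ?Y2"
        using c1 c \<theta>[of b] L(1) by (intro mult_right_mono mult_mono) auto
      finally show ?thesis .
    qed
    moreover have "0 \<le> 2 * (1 / c * (1 / ?\<theta> a)) * ((h a)\<^sup>2 * (norm (u a))\<^sup>2)"
      using c \<theta>[of a] by simp
    ultimately have "2 * (h a * (u a \<bullet> (u a /\<^sub>R ?\<theta> a - u b /\<^sub>R ?\<theta> b))) \<le> 1 / L * ?Y1 + 1 / L * (1 / L) * ?Y2"
      unfolding eq by linarith
    then have "s a b * (2 * (h a * (u a \<bullet> (u a /\<^sub>R ?\<theta> a - u b /\<^sub>R ?\<theta> b))))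
        \<le> s a b * (1 / L * ?Y1 + 1 / L * (1 / L) * ?Y2)"
      by (intro mult_left_mono s)
    also have "\<dots> \<le> P * (1 / L * ?Y1 + 1 / L * (1 / L) * ?Y2)"
      using L(1) by (intro mult_right_mono s) auto
    finally show ?thesis by (simp add: algebra_simps power2_eq_square)
  qed
  have nb: "(\<Sum>b\<in>UNIV. (norm (u a - u b))\<^sup>2) = ?n * (norm (u a))\<^sup>2 + W" for a
  proof -
    have "(\<Sum>b\<in>UNIV. (norm (u a - u b))\<^sup>2)
        = (\<Sum>b\<in>UNIV. (norm (u a))\<^sup>2 + (norm (u b))\<^sup>2 - 2 * (u a \<bullet> u b))"
      by (simp add: power2_norm_eq_inner algebra_simps inner_commute)
    also have "\<dots> = ?n * (norm (u a))\<^sup>2 + W - 2 * (u a \<bullet> (\<Sum>b\<in>UNIV. u b))"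
      by (simp add: sum.distrib sum_subtractf W_def inner_sum_right sum_distrib_left)
    finally show ?thesis using u0 by simp
  qed
  have leW: "(norm (u a))\<^sup>2 \<le> W" for a
    unfolding W_def by (rule member_le_sum) auto
  have q1: "(\<Sum>a\<in>UNIV. \<Sum>b\<in>UNIV. (norm (u a))\<^sup>2 * (norm (u a - u b))\<^sup>2) \<le> 2 * ?n * W\<^sup>2"
  proof -
    have "(\<Sum>a\<in>UNIV. \<Sum>b\<in>UNIV. (norm (u a))\<^sup>2 * (norm (u a - u b))\<^sup>2)
        = (\<Sum>a\<in>UNIV. (norm (u a))\<^sup>2 * (?n * (norm (u a))\<^sup>2 + W))"
      by (simp add: nb flip: sum_distrib_left)
    also have "\<dots> \<le> (\<Sum>a\<in>UNIV. (norm (u a))\<^sup>2 * (?n * W + ?n * W))"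
      using leW n1 W0 by (intro sum_mono mult_left_mono add_mono) (auto simp: mult_le_cancel_right1)
    also have "\<dots> = 2 * ?n * W\<^sup>2"
      by (simp add: power2_eq_square W_def flip: sum_distrib_right)
    finally show ?thesis .
  qed
  have q2: "(\<Sum>a\<in>UNIV. (h a)\<^sup>2 * (norm (u a))\<^sup>2) \<le> W * H"
    unfolding H_def sum_distrib_left
    by (intro sum_mono) (subst mult.commute, intro mult_right_mono leW, simp)
  have "2 * (\<Sum>a\<in>UNIV. \<Sum>b\<in>UNIV. s a b * (h a * (u a \<bullet> (u a /\<^sub>R ?\<theta> a - u b /\<^sub>R ?\<theta> b))))
      \<le> (\<Sum>a\<in>UNIV. \<Sum>b\<in>UNIV. P / L * ((h a)\<^sup>2 + (norm (u a))\<^sup>2 * (norm (u a - u b))\<^sup>2)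
        + P / L\<^sup>2 * ((h a)\<^sup>2 * (norm (u a))\<^sup>2 + (h b)\<^sup>2 * (norm (u b))\<^sup>2))"
    unfolding sum_distrib_left[of 2] by (intro sum_mono pair)
  also have "\<dots> = P / L * (?n * H + (\<Sum>a\<in>UNIV. \<Sum>b\<in>UNIV. (norm (u a))\<^sup>2 * (norm (u a - u b))\<^sup>2))
      + P / L\<^sup>2 * (2 * ?n * (\<Sum>a\<in>UNIV. (h a)\<^sup>2 * (norm (u a))\<^sup>2))"
    by (simp only: sum.distrib H_def sum_constant flip: sum_distrib_left) simp
  also have "\<dots> \<le> P / L * (?n * H + 2 * ?n * W\<^sup>2) + P / L\<^sup>2 * (2 * ?n * (W * H))"
    using q1 q2 P L(1) by (intro add_mono mult_left_mono) auto
  finally show ?thesis by (simp add: algebra_simps)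
qed

section \<open>Differential inequalities and continuation in time\<close>

text \<open>
  The function \<open>f s * exp (a * s)\<close> minus the explicit integral of the forcing is nonincreasing. The
  resonant case \<open>a = r\<close>, where that integral is linear in \<open>s\<close>, is excluded. For \<open>A = 0\<close> this is the
  homogeneous Gronwall inequality.
\<close>

lemma exponential_gronwall:
  fixes f f' :: "real \<Rightarrow> real"
  assumes "0 \<le> b" and "a \<noteq> r"
    and deriv: "\<And>s. 0 \<le> s \<Longrightarrow> s \<le> b \<Longrightarrow> (f has_real_derivative f' s) (at s within {0..})"
    and le: "\<And>s. 0 \<le> s \<Longrightarrow> s \<le> b \<Longrightarrow> f' s \<le> - a * f s + A * exp (- r * s)"
  shows "f b \<le> f 0 * exp (- a * b) + A / (a - r) * (exp (- r * b) - exp (- a * b))"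
proof -
  define d where "d = a - r"
  have d: "d \<noteq> 0" using \<open>a \<noteq> r\<close> by (simp add: d_def)
  define h where "h s = f s * exp (a * s) - A / d * exp (d * s)" for s
  have hd: "(h has_real_derivative (f' s + a * f s) * exp (a * s) - A * exp (d * s)) (at s within {0..})"
    if "0 \<le> s" "s \<le> b" for s
    unfolding h_def using d
    by (auto intro!: derivative_eq_intros deriv that simp: algebra_simps)
  have "h b \<le> h 0"
  proof (rule DERIV_nonpos_imp_decreasing_open[OF \<open>0 \<le> b\<close>])
    fix s assume s: "0 < s" "s < b"
    have "(f' s + a * f s) * exp (a * s) \<le> A * exp (- r * s) * exp (a * s)"
      using le[of s] s by (intro mult_right_mono) auto
    also have "\<dots> = A * exp (d * s)" by (simp add: d_def algebra_simps flip: exp_add)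
    finally show "\<exists>y. DERIV h s :> y \<and> y \<le> 0"
      using hd[of s] s at_within_interior[of s "{0..}"]
      by (intro exI[of _ "(f' s + a * f s) * exp (a * s) - A * exp (d * s)"]) auto
  next
    show "continuous_on {0..b} h"
      unfolding continuous_on_eq_continuous_within
      by (intro ballI continuous_within_subset[OF DERIV_continuous[OF hd]]) auto
  qed
  then have "h b * exp (- a * b) \<le> h 0 * exp (- a * b)" by (intro mult_right_mono) auto
  then show ?thesis
    unfolding h_def d_def by (simp add: algebra_simps flip: exp_add)
qed

text \<open>
  A first time at which \<open>f\<close> attains \<open>c\<close> would satisfy the weak bound on its whole past, contradicting
  the improvement to a strict bound.
\<close>

lemma continuity_bootstrap:
  fixes f :: "real \<Rightarrow> real"
  assumes cont: "continuous_on {0..} f" and init: "f 0 < c"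
    and improve: "\<And>b. 0 \<le> b \<Longrightarrow> (\<And>s. 0 \<le> s \<Longrightarrow> s \<le> b \<Longrightarrow> f s \<le> c) \<Longrightarrow> f b < c"
    and "0 \<le> t"
  shows "f t < c"
proof (rule ccontr)
  assume "\<not> f t < c"
  have cont': "continuous_on {0..t} f" using cont by (rule continuous_on_subset) auto
  have hits: "\<exists>s\<in>{0..b}. f s = c" if "0 \<le> b" "b \<le> t" "c \<le> f b" for b
    using IVT'[of f 0 c b] that init continuous_on_subset[OF cont, of "{0..b}"] by force
  define S where "S = {s \<in> {0..t}. f s = c}"
  have "closed S"
    unfolding S_def by (rule continuous_closed_preimage_constant[OF cont']) simp
  then have "compact S"
    using compact_Int_closed[of "{0..t}" S] by (simp add: S_def Int_def cong: conj_cong)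
  moreover have "S \<noteq> {}"
    using hits[of t] \<open>\<not> f t < c\<close> \<open>0 \<le> t\<close> by (auto simp: S_def)
  ultimately obtain m where m: "m \<in> S" and least: "\<And>s. s \<in> S \<Longrightarrow> m \<le> s"
    using compact_attains_inf[of S] by blast
  have "f s \<le> c" if "0 \<le> s" "s \<le> m" for s
  proof (rule ccontr)
    assume "\<not> f s \<le> c"
    then have "\<exists>r\<in>{0..s}. f r = c"
      using that m by (intro hits) (auto simp: S_def)
    then obtain r where "r \<in> {0..s}" "f r = c" by blast
    then have "m \<le> r" using least[of r] that m by (auto simp: S_def)
    then have "s = r" using that \<open>r \<in> {0..s}\<close> by auto
    then show False using \<open>f r = c\<close> \<open>\<not> f s \<le> c\<close> by simp
  qed
  then have "f m < c" using m by (intro improve) (auto simp: S_def)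
  then show False using m by (simp add: S_def)
qed

section \<open>Deviations from the centre of mass\<close>

lemma sum_deviation_eq_0:
  fixes y :: "'n::finite \<Rightarrow> real \<Rightarrow> 'b::real_vector"
  shows "(\<Sum>\<alpha>\<in>UNIV. y \<alpha> t - center y t) = 0"
  by (simp add: center_def sum_subtractf sum_constant_scaleR)

lemma sum_norm_squared_decomposition:
  fixes y :: "'n::finite \<Rightarrow> real \<Rightarrow> 'b::real_inner"
  shows "(\<Sum>\<alpha>\<in>UNIV. (norm (y \<alpha> t))\<^sup>2)
    = (\<Sum>\<alpha>\<in>UNIV. (norm (y \<alpha> t - center y t))\<^sup>2) + real CARD('n) * (norm (center y t))\<^sup>2"
proof -
  have "(\<Sum>\<alpha>\<in>UNIV. (norm (y \<alpha> t))\<^sup>2) = (\<Sum>\<alpha>\<in>UNIV. (norm (y \<alpha> t - center y t))\<^sup>2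
      + (norm (center y t))\<^sup>2 + 2 * ((y \<alpha> t - center y t) \<bullet> center y t))"
    by (simp add: power2_norm_eq_inner algebra_simps inner_commute)
  also have "\<dots> = (\<Sum>\<alpha>\<in>UNIV. (norm (y \<alpha> t - center y t))\<^sup>2) + real CARD('n) * (norm (center y t))\<^sup>2
      + 2 * ((\<Sum>\<alpha>\<in>UNIV. y \<alpha> t - center y t) \<bullet> center y t)"
    by (simp only: sum.distrib inner_sum_left sum_constant flip: sum_distrib_left)
  finally show ?thesis by (simp add: sum_deviation_eq_0)
qed

lemma has_vector_derivative_center:
  fixes y :: "'n::finite \<Rightarrow> real \<Rightarrow> 'b::real_normed_vector"
  assumes "\<And>\<alpha>. (y \<alpha> has_vector_derivative y' \<alpha>) F"
  shows "(center y has_vector_derivative (1 / real CARD('n)) *\<^sub>R (\<Sum>\<alpha>\<in>UNIV. y' \<alpha>)) F"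
  unfolding center_def[abs_def]
  by (intro bounded_linear.has_vector_derivative[OF bounded_linear_scaleR_right] has_vector_derivative_sum assms)

lemma has_real_derivative_inner:
  fixes f g :: "real \<Rightarrow> 'b::real_inner"
  assumes "(f has_vector_derivative f') (at t within S)" "(g has_vector_derivative g') (at t within S)"
  shows "((\<lambda>s. f s \<bullet> g s) has_real_derivative f t \<bullet> g' + f' \<bullet> g t) (at t within S)"
  using has_derivative_inner[OF assms[unfolded has_vector_derivative_def]]
  unfolding has_field_derivative_def
  by (rule has_derivative_eq_rhs) (simp add: fun_eq_iff algebra_simps)

lemma has_real_derivative_norm_squared:
  fixes f :: "real \<Rightarrow> 'b::real_inner"
  assumes "(f has_vector_derivative f') (at t within S)"
  shows "((\<lambda>s. (norm (f s))\<^sup>2) has_real_derivative 2 * (f t \<bullet> f')) (at t within S)"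
  using has_real_derivative_inner[OF assms assms]
  by (simp add: power2_norm_eq_inner inner_commute)

lemma constant_on_nonneg:
  fixes f :: "real \<Rightarrow> real"
  assumes "\<And>t. 0 \<le> t \<Longrightarrow> (f has_real_derivative 0) (at t within {0..})" and "0 \<le> t"
  shows "f t = f 0"
proof -
  obtain c where "\<And>s. s \<in> {0..} \<Longrightarrow> f s = c"
    using has_field_derivative_zero_constant[of "{0..}" f] assms(1) by auto
  then show ?thesis using \<open>0 \<le> t\<close> by simp
qed

section \<open>Conservation laws and the equations for the deviations\<close>

locale harmonic_TCS =
  fixes \<kappa>1 \<kappa>2 :: real and \<phi> \<zeta> :: "real \<Rightarrow> real"
    and x v :: "'n::finite \<Rightarrow> real \<Rightarrow> real ^ 'd" and T :: "'n \<Rightarrow> real \<Rightarrow> real"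
  assumes solution: "TCS_harmonic_solution \<kappa>1 \<kappa>2 \<phi> \<zeta> x v T"
begin

abbreviation F :: "'n \<Rightarrow> real \<Rightarrow> real ^ 'd" where "F \<equiv> coupling \<kappa>1 \<phi> x v T"

definition dx :: "'n \<Rightarrow> real \<Rightarrow> real ^ 'd" where "dx \<alpha> t = x \<alpha> t - center x t"
definition dv :: "'n \<Rightarrow> real \<Rightarrow> real ^ 'd" where "dv \<alpha> t = v \<alpha> t - center v t"
definition dT :: "'n \<Rightarrow> real \<Rightarrow> real" where "dT \<alpha> t = T \<alpha> t - T_inf v T t"

abbreviation \<Phi> :: "real \<Rightarrow> 'n \<Rightarrow> 'n \<Rightarrow> real" where "\<Phi> t \<alpha> \<beta> \<equiv> \<phi> (norm (x \<alpha> t - x \<beta> t))"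
abbreviation Z :: "real \<Rightarrow> 'n \<Rightarrow> 'n \<Rightarrow> real" where "Z t \<alpha> \<beta> \<equiv> \<zeta> (norm (x \<alpha> t - x \<beta> t))"

lemma fluct_squared:
  "(fluct x t)\<^sup>2 = (\<Sum>\<alpha>\<in>UNIV. (norm (dx \<alpha> t))\<^sup>2)"
  "(fluct v t)\<^sup>2 = (\<Sum>\<alpha>\<in>UNIV. (norm (dv \<alpha> t))\<^sup>2)"
  "(temp_fluct v T t)\<^sup>2 = (\<Sum>\<alpha>\<in>UNIV. (dT \<alpha> t)\<^sup>2)"
  by (simp_all add: fluct_def temp_fluct_def dx_def dv_def dT_def sum_nonneg)

lemma sum_dv_eq_0: "(\<Sum>\<alpha>\<in>UNIV. dv \<alpha> t) = 0"
  unfolding dv_def by (rule sum_deviation_eq_0)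

lemma coupling_eq:
  "F \<alpha> t = (\<kappa>1 / real CARD('n)) *\<^sub>R (\<Sum>\<beta>\<in>UNIV. \<Phi> t \<alpha> \<beta> *\<^sub>R (dv \<beta> t /\<^sub>R T \<beta> t - dv \<alpha> t /\<^sub>R T \<alpha> t))"
  by (simp add: coupling_def dv_def)

lemma sum_coupling_eq_0: "(\<Sum>\<alpha>\<in>UNIV. F \<alpha> t) = 0"
proof -
  have "(\<Sum>\<alpha>\<in>UNIV. \<Sum>\<beta>\<in>UNIV. \<Phi> t \<alpha> \<beta> *\<^sub>R (dv \<beta> t /\<^sub>R T \<beta> t - dv \<alpha> t /\<^sub>R T \<alpha> t)) = 0"
    by (rule sum_sum_antisymmetric) (simp add: norm_minus_commute algebra_simps)
  then show ?thesis by (simp add: coupling_eq flip: scaleR_sum_right)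
qed

lemma x_deriv: "0 \<le> t \<Longrightarrow> (x \<alpha> has_vector_derivative v \<alpha> t) (at t within {0..})"
  and v_deriv: "0 \<le> t \<Longrightarrow> (v \<alpha> has_vector_derivative F \<alpha> t - x \<alpha> t) (at t within {0..})"
  and energy_deriv: "0 \<le> t \<Longrightarrow> ((\<lambda>s. T \<alpha> s + 1/2 * (norm (v \<alpha> s))\<^sup>2) has_real_derivative
      \<kappa>2 / real CARD('n) * (\<Sum>\<beta>\<in>UNIV. Z t \<alpha> \<beta> * (1 / T \<alpha> t - 1 / T \<beta> t)) + F \<alpha> t \<bullet> center v t) (at t within {0..})"
  using solution unfolding TCS_harmonic_solution_def by blast+

lemma center_x_deriv: "0 \<le> t \<Longrightarrow> (center x has_vector_derivative center v t) (at t within {0..})"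
  using has_vector_derivative_center[of x "\<lambda>\<alpha>. v \<alpha> t", OF x_deriv] by (simp add: center_def)

lemma center_v_deriv: "0 \<le> t \<Longrightarrow> (center v has_vector_derivative - center x t) (at t within {0..})"
  using has_vector_derivative_center[of v "\<lambda>\<alpha>. F \<alpha> t - x \<alpha> t", OF v_deriv]
  by (simp add: center_def sum_subtractf sum_coupling_eq_0)

lemma dx_deriv: "0 \<le> t \<Longrightarrow> (dx \<alpha> has_vector_derivative dv \<alpha> t) (at t within {0..})"
  unfolding dx_def[abs_def] dv_def
  by (intro has_vector_derivative_diff x_deriv center_x_deriv)

lemma dv_deriv: "0 \<le> t \<Longrightarrow> (dv \<alpha> has_vector_derivative F \<alpha> t - dx \<alpha> t) (at t within {0..})"
  unfolding dv_def[abs_def] dx_def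
  using has_vector_derivative_diff[OF v_deriv center_v_deriv] by (simp add: algebra_simps)

text \<open>
  The centres solve the free harmonic oscillator. Its constant energy bounds the speed of the centre, hence
  \<open>T_inf\<close>, and it is the factor \<open>zc_norm0\<close> in the drift term of the temperature estimate.
\<close>

lemma center_oscillation_energy:
  assumes "0 \<le> t"
  shows "(norm (center v t))\<^sup>2 + (norm (center x t))\<^sup>2 = (zc_norm0 x v)\<^sup>2"
proof -
  have "((\<lambda>s. (norm (center v s))\<^sup>2 + (norm (center x s))\<^sup>2) has_real_derivative 0) (at s within {0..})"
    if "0 \<le> s" for s
    using DERIV_add[OF has_real_derivative_norm_squared[OF center_v_deriv[OF that]]
        has_real_derivative_norm_squared[OF center_x_deriv[OF that]]]
    by (simp add: inner_commute)
  from constant_on_nonneg[OF this assms] show ?thesis by (simp add: zc_norm0_def)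
qed

lemma sum_energy_exchange_eq_0:
  "(\<Sum>\<alpha>\<in>UNIV. \<Sum>\<beta>\<in>UNIV. Z t \<alpha> \<beta> * (1 / T \<alpha> t - 1 / T \<beta> t)) = 0"
  by (rule sum_sum_antisymmetric) (simp add: norm_minus_commute algebra_simps)

lemma total_energy:
  assumes "0 \<le> t"
  shows "(\<Sum>\<alpha>\<in>UNIV. T \<alpha> t + 1/2 * (norm (v \<alpha> t))\<^sup>2) = real CARD('n) * T_M v T"
proof -
  have "((\<lambda>s. \<Sum>\<alpha>\<in>UNIV. T \<alpha> s + 1/2 * (norm (v \<alpha> s))\<^sup>2) has_real_derivative 0) (at s within {0..})"
    if "0 \<le> s" for s
  proof -
    have "(\<Sum>\<alpha>\<in>UNIV. \<kappa>2 / real CARD('n) * (\<Sum>\<beta>\<in>UNIV. Z s \<alpha> \<beta> * (1 / T \<alpha> s - 1 / T \<beta> s)) + F \<alpha> s \<bullet> center v s)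
        = \<kappa>2 / real CARD('n) * (\<Sum>\<alpha>\<in>UNIV. \<Sum>\<beta>\<in>UNIV. Z s \<alpha> \<beta> * (1 / T \<alpha> s - 1 / T \<beta> s))
          + (\<Sum>\<alpha>\<in>UNIV. F \<alpha> s) \<bullet> center v s"
      by (simp only: sum.distrib inner_sum_left flip: sum_distrib_left)
    also have "\<dots> = 0" by (simp only: sum_energy_exchange_eq_0 sum_coupling_eq_0) simp
    finally have zero: "(\<Sum>\<alpha>\<in>UNIV. \<kappa>2 / real CARD('n) * (\<Sum>\<beta>\<in>UNIV. Z s \<alpha> \<beta> * (1 / T \<alpha> s - 1 / T \<beta> s))
        + F \<alpha> s \<bullet> center v s) = 0" .
    show ?thesis
      by (rule DERIV_cong[OF _ zero]) (intro DERIV_sum energy_deriv that)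
  qed
  from constant_on_nonneg[OF this assms]
  have "(\<Sum>\<alpha>\<in>UNIV. T \<alpha> t + 1/2 * (norm (v \<alpha> t))\<^sup>2)
      = (\<Sum>\<alpha>\<in>UNIV. T \<alpha> 0) + 1/2 * (\<Sum>\<alpha>\<in>UNIV. (norm (v \<alpha> 0))\<^sup>2)"
    by (simp only: sum.distrib sum_distrib_left)
  also have "\<dots> = real CARD('n) * T_M v T"
    by (simp add: T_M_def center_def distrib_left)
  finally show ?thesis .
qed

lemma T_inf_eq: "T_inf v T t = T_M v T - (norm (center v t))\<^sup>2 / 2"
  by (simp add: T_inf_def T_M_def)

lemma T_m_eq: "T_m x v T = T_M v T - (zc_norm0 x v)\<^sup>2"
  by (simp add: T_m_def T_M_def zc_norm0_def)

text \<open>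
  The total energy is conserved and \<open>T_inf\<close> is the common temperature for which it would consist
  of internal energy and the motion of the centre alone. What is missing is the kinetic energy of the deviations.
\<close>

lemma sum_dT:
  assumes "0 \<le> t"
  shows "(\<Sum>\<alpha>\<in>UNIV. dT \<alpha> t) = - (\<Sum>\<alpha>\<in>UNIV. (norm (dv \<alpha> t))\<^sup>2) / 2"
proof -
  have "(\<Sum>\<alpha>\<in>UNIV. dT \<alpha> t) = (\<Sum>\<alpha>\<in>UNIV. T \<alpha> t) - real CARD('n) * T_inf v T t"
    by (simp add: dT_def sum_subtractf)
  moreover have "(\<Sum>\<alpha>\<in>UNIV. T \<alpha> t) + 1/2 * (\<Sum>\<alpha>\<in>UNIV. (norm (v \<alpha> t))\<^sup>2) = real CARD('n) * T_M v T"
    using total_energy[OF assms] by (simp only: sum.distrib sum_distrib_left)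
  ultimately show ?thesis
    using sum_norm_squared_decomposition[of v t]
    by (simp add: T_inf_eq dv_def right_diff_distrib add_divide_distrib)
qed

lemma T_inf_bounds:
  assumes "0 \<le> t"
  shows "T_m x v T \<le> T_inf v T t" "T_inf v T t \<le> T_M v T"
proof -
  have "0 \<le> (norm (center v t))\<^sup>2" "0 \<le> (norm (center x t))\<^sup>2" by simp_all
  then show "T_m x v T \<le> T_inf v T t" "T_inf v T t \<le> T_M v T"
    using center_oscillation_energy[OF assms] unfolding T_inf_eq T_m_eq by linarith+
qed

text \<open>
  The coupling does work \<open>F \<bullet> v\<close> on a particle, of which only \<open>F \<bullet> center v\<close> is supplied to its energy;
  the difference \<open>- F \<bullet> dv\<close> is frictional heat. The energy balance has no potential term, so the kinetic
  energy \<open>x \<bullet> v\<close> lost to the harmonic force reappears as heat; subtracting the change of \<open>T_inf\<close>, which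
  is \<open>center x \<bullet> center v\<close>, leaves the last three terms.
\<close>

lemma dT_deriv:
  assumes "0 \<le> t"
  shows "(dT \<alpha> has_real_derivative
      \<kappa>2 / real CARD('n) * (\<Sum>\<beta>\<in>UNIV. Z t \<alpha> \<beta> * (1 / T \<alpha> t - 1 / T \<beta> t)) - F \<alpha> t \<bullet> dv \<alpha> t
      + dx \<alpha> t \<bullet> dv \<alpha> t + (dx \<alpha> t \<bullet> center v t + center x t \<bullet> dv \<alpha> t)) (at t within {0..})"
proof -
  let ?R = "\<kappa>2 / real CARD('n) * (\<Sum>\<beta>\<in>UNIV. Z t \<alpha> \<beta> * (1 / T \<alpha> t - 1 / T \<beta> t))"
  have "dT \<alpha> = (\<lambda>s. T \<alpha> s + 1/2 * (norm (v \<alpha> s))\<^sup>2 - 1/2 * (norm (v \<alpha> s))\<^sup>2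
      + 1/2 * (norm (center v s))\<^sup>2 - T_M v T)"
    by (simp add: fun_eq_iff dT_def T_inf_eq)
  moreover have "((\<lambda>s. T \<alpha> s + 1/2 * (norm (v \<alpha> s))\<^sup>2 - 1/2 * (norm (v \<alpha> s))\<^sup>2
      + 1/2 * (norm (center v s))\<^sup>2 - T_M v T) has_real_derivative
      ?R + F \<alpha> t \<bullet> center v t - 1/2 * (2 * (v \<alpha> t \<bullet> (F \<alpha> t - x \<alpha> t)))
      + 1/2 * (2 * (center v t \<bullet> (- center x t))) - 0) (at t within {0..})"
    by (intro DERIV_diff[OF _ DERIV_const] DERIV_add DERIV_diff DERIV_cmult energy_deriv
        has_real_derivative_norm_squared v_deriv center_v_deriv assms)
  moreover have "?R + F \<alpha> t \<bullet> center v t - 1/2 * (2 * (v \<alpha> t \<bullet> (F \<alpha> t - x \<alpha> t)))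
      + 1/2 * (2 * (center v t \<bullet> (- center x t))) - 0
      = ?R - F \<alpha> t \<bullet> dv \<alpha> t + dx \<alpha> t \<bullet> dv \<alpha> t + (dx \<alpha> t \<bullet> center v t + center x t \<bullet> dv \<alpha> t)"
    by (simp add: dv_def dx_def inner_diff_left inner_diff_right inner_commute diff_divide_distrib)
  ultimately show ?thesis by (simp only:)
qed

end

section \<open>The confined regime\<close>

text \<open>
  The last two assumptions are what the two steps of the velocity estimate consume: \<open>coercive\<close> makes the
  defect due to unequal temperatures at most half of the alignment, and \<open>fast\<close> lets the remaining half
  dominate everything that the cross term of the Lyapunov functional produces in the velocities.
\<close>

locale flocking_regime = harmonic_TCS \<kappa>1 \<kappa>2 \<phi> \<zeta> x v T
  for \<kappa>1 \<kappa>2 :: real and \<phi> \<zeta> :: "real \<Rightarrow> real"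
    and x v :: "'n::finite \<Rightarrow> real \<Rightarrow> real ^ 'd" and T :: "'n \<Rightarrow> real \<Rightarrow> real" +
  fixes \<delta> \<epsilon>0 \<epsilon> :: real
  assumes kappa_pos: "0 < \<kappa>1" "0 < \<kappa>2"
    and weights_nonneg: "\<And>r. 0 \<le> r \<Longrightarrow> 0 \<le> \<phi> r" "\<And>r. 0 \<le> r \<Longrightarrow> 0 \<le> \<zeta> r"
    and weights_antimono: "antimono_on {0..} \<phi>" "antimono_on {0..} \<zeta>"
    and delta: "1 < \<delta>" and eps0: "0 < \<epsilon>0" and T_m_large: "\<delta> * \<epsilon>0 \<le> T_m x v T"
    and eps: "0 < \<epsilon>" "\<epsilon> \<le> 1/2"
    and coercive: "2 * (T_M v T + \<epsilon>0) * \<phi> 0 / ((\<delta> - 1) * (T_m x v T - \<epsilon>0)) \<le> \<phi> (3 * sqrt 2 * \<epsilon>0)"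
    and fast: "\<epsilon> * (2 + 3 * (\<kappa>1 * \<phi> 0)\<^sup>2 / (T_m x v T - \<epsilon>0)\<^sup>2)
      \<le> \<kappa>1 / (2 * (T_M v T + \<epsilon>0)) * \<phi> (3 * sqrt 2 * \<epsilon>0)"
begin

definition L :: real where "L = T_m x v T - \<epsilon>0"
definition U :: real where "U = T_M v T + \<epsilon>0"
definition p :: real where "p = \<phi> (3 * sqrt 2 * \<epsilon>0)"
definition q :: real where "q = \<zeta> (3 * sqrt 2 * \<epsilon>0)"

text \<open>
  The radius \<open>3 * \<epsilon>0\<close> leaves room over the bound \<open>sqrt 6 * \<epsilon>0\<close> that the decay estimate returns,
  and it makes distances at most \<open>3 * sqrt 2 * \<epsilon>0\<close>, the argument at which the weights are evaluated.
\<close>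

definition confined :: "real \<Rightarrow> bool" where
  "confined t \<longleftrightarrow> 0 \<le> t \<and> temp_fluct v T t \<le> \<epsilon>0 \<and> fluct x t \<le> 3 * \<epsilon>0"

abbreviation \<X> :: "real \<Rightarrow> real" where "\<X> t \<equiv> \<Sum>\<alpha>\<in>UNIV. (norm (dx \<alpha> t))\<^sup>2"
abbreviation \<V> :: "real \<Rightarrow> real" where "\<V> t \<equiv> \<Sum>\<alpha>\<in>UNIV. (norm (dv \<alpha> t))\<^sup>2"
abbreviation \<T> :: "real \<Rightarrow> real" where "\<T> t \<equiv> \<Sum>\<alpha>\<in>UNIV. (dT \<alpha> t)\<^sup>2"

lemma L_ge: "(\<delta> - 1) * \<epsilon>0 \<le> L" and L_pos: "0 < L"
proof -
  show 1: "(\<delta> - 1) * \<epsilon>0 \<le> L" using T_m_large by (simp add: L_def algebra_simps)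
  have "0 < (\<delta> - 1) * \<epsilon>0" using delta eps0 by simp
  then show "0 < L" using 1 by linarith
qed

lemma U_pos: "0 < U"
proof -
  have "T_m x v T \<le> T_M v T" using T_inf_bounds[of 0] by simp
  then show ?thesis using L_pos eps0 by (simp add: L_def U_def)
qed

lemma weight_values_nonneg: "0 \<le> p" "0 \<le> q" "0 \<le> \<phi> 0"
  using eps0 weights_nonneg by (simp_all add: p_def q_def)

lemma temperature_bounds:
  assumes "0 \<le> t" "temp_fluct v T t \<le> \<epsilon>0"
  shows "\<bar>dT \<alpha> t\<bar> \<le> \<epsilon>0" "L \<le> T \<alpha> t" "T \<alpha> t \<le> U" "L \<le> T_inf v T t"
proof -
  have "\<bar>dT \<alpha> t\<bar>\<^sup>2 \<le> (temp_fluct v T t)\<^sup>2"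
    unfolding fluct_squared using member_le_sum[of \<alpha> UNIV "\<lambda>\<alpha>. (dT \<alpha> t)\<^sup>2"] by simp
  then have "\<bar>dT \<alpha> t\<bar> \<le> temp_fluct v T t"
    by (rule power2_le_imp_le) (simp add: temp_fluct_def sum_nonneg)
  then show "\<bar>dT \<alpha> t\<bar> \<le> \<epsilon>0" using assms by simp
  then show "L \<le> T \<alpha> t" "T \<alpha> t \<le> U" "L \<le> T_inf v T t"
    using T_inf_bounds[OF assms(1)] eps0 unfolding dT_def L_def U_def abs_le_iff by linarith+
qed

text \<open>
  For two different particles, \<open>|dx \<alpha> - dx \<beta>|\<^sup>2 \<le> 2 * (|dx \<alpha>|\<^sup>2 + |dx \<beta>|\<^sup>2)\<close>, and both squares occur
  in the square of the position fluctuation; this gives the factor \<open>sqrt 2\<close> instead of \<open>2\<close>.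
\<close>

lemma distance_bound:
  assumes "fluct x t \<le> 3 * \<epsilon>0"
  shows "norm (x \<alpha> t - x \<beta> t) \<le> 3 * sqrt 2 * \<epsilon>0"
proof (cases "\<alpha> = \<beta>")
  case True then show ?thesis using eps0 by simp
next
  case False
  have "(norm (x \<alpha> t - x \<beta> t))\<^sup>2 = 2 * ((norm (dx \<alpha> t))\<^sup>2 + (norm (dx \<beta> t))\<^sup>2) - (norm (dx \<alpha> t + dx \<beta> t))\<^sup>2"
  proof -
    have "x \<alpha> t - x \<beta> t = dx \<alpha> t - dx \<beta> t" by (simp add: dx_def)
    then show ?thesis
      unfolding power2_norm_eq_inner by (simp add: inner_commute inner_add_left inner_diff_left
          inner_add_right inner_diff_right)
  qed
  also have "\<dots> \<le> 2 * (\<Sum>\<gamma>\<in>{\<alpha>, \<beta>}. (norm (dx \<gamma> t))\<^sup>2)" using False by simp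
  also have "\<dots> \<le> 2 * \<X> t" by (intro mult_left_mono sum_mono2) auto
  also have "\<dots> \<le> 2 * (3 * \<epsilon>0)\<^sup>2"
    using assms unfolding fluct_squared(1)[symmetric]
    by (intro mult_left_mono power_mono) (auto simp: fluct_def sum_nonneg)
  also have "\<dots> = (3 * sqrt 2 * \<epsilon>0)\<^sup>2" by (simp add: power_mult_distrib)
  finally show ?thesis by (rule power2_le_imp_le) (use eps0 in auto)
qed

lemma weight_bounds:
  assumes "fluct x t \<le> 3 * \<epsilon>0"
  shows "p \<le> \<Phi> t \<alpha> \<beta>" "\<Phi> t \<alpha> \<beta> \<le> \<phi> 0" "q \<le> Z t \<alpha> \<beta>"
proof -
  note d = distance_bound[OF assms, of \<alpha> \<beta>]
  have r: "0 \<le> 3 * sqrt 2 * \<epsilon>0" using eps0 by simp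
  show "p \<le> \<Phi> t \<alpha> \<beta>"
    unfolding p_def by (rule monotone_onD[OF weights_antimono(1) _ _ d]) (use r in auto)
  show "\<Phi> t \<alpha> \<beta> \<le> \<phi> 0"
    by (rule monotone_onD[OF weights_antimono(1)]) auto
  show "q \<le> Z t \<alpha> \<beta>"
    unfolding q_def by (rule monotone_onD[OF weights_antimono(2) _ _ d]) (use r in auto)
qed

section \<open>Exponential flocking\<close>

text \<open>
  Here \<open>coupling_dissipation\<close> is applied with \<open>K = 2 / ((\<delta> - 1) * L)\<close>. The temperatures differ by at
  most \<open>2 * \<epsilon>0\<close>; in the denominator of \<open>1 / T \<alpha> - 1 / T \<beta>\<close> one factor is estimated by \<open>L\<close> and the
  other by \<open>(\<delta> - 1) * \<epsilon>0\<close>, so that \<open>\<epsilon>0\<close> cancels. By \<open>coercive\<close> half of the damping survives.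
\<close>

lemma alignment_dissipation:
  assumes "confined t"
  shows "(\<Sum>\<alpha>\<in>UNIV. dv \<alpha> t \<bullet> F \<alpha> t) \<le> - (\<kappa>1 / (2 * U) * p) * \<V> t"
proof -
  have t: "0 \<le> t" and c: "temp_fluct v T t \<le> \<epsilon>0" "fluct x t \<le> 3 * \<epsilon>0"
    using assms by (auto simp: confined_def)
  note tb = temperature_bounds[OF t c(1)]
  have pos: "0 < T \<alpha> t" for \<alpha> using tb(2)[of \<alpha>] L_pos by linarith
  define K where "K = 2 / ((\<delta> - 1) * L)"
  have K: "1 / T \<alpha> t - 1 / T \<beta> t \<le> K" for \<alpha> \<beta>
  proof -
    have "T \<beta> t - T \<alpha> t \<le> 2 * \<epsilon>0" using tb(1)[of \<alpha>] tb(1)[of \<beta>] unfolding dT_def by linarith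
    moreover have "(\<delta> - 1) * \<epsilon>0 * L \<le> T \<alpha> t * T \<beta> t"
      using tb(2)[of \<alpha>] tb(2)[of \<beta>] L_ge L_pos delta eps0 by (intro mult_mono) auto
    ultimately have "(T \<beta> t - T \<alpha> t) / (T \<alpha> t * T \<beta> t) \<le> 2 * \<epsilon>0 / ((\<delta> - 1) * \<epsilon>0 * L)"
      using delta eps0 L_pos pos by (intro frac_le) auto
    moreover have "(T \<beta> t - T \<alpha> t) / (T \<alpha> t * T \<beta> t) = 1 / T \<alpha> t - 1 / T \<beta> t"
      using pos[of \<alpha>] pos[of \<beta>] by (simp add: field_simps)
    moreover have "2 * \<epsilon>0 / ((\<delta> - 1) * \<epsilon>0 * L) = K" using eps0 by (simp add: K_def)
    ultimately show ?thesis by simp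
  qed
  have "\<bar>1 / T \<alpha> t - 1 / T \<beta> t\<bar> \<le> K" for \<alpha> \<beta> using K[of \<alpha> \<beta>] K[of \<beta> \<alpha>] by linarith
  from coupling_dissipation[OF _ weight_bounds(1,2)[OF c(2)] weight_values_nonneg(1) pos tb(3) this sum_dv_eq_0]
  have "(\<Sum>\<alpha>\<in>UNIV. \<Sum>\<beta>\<in>UNIV. \<Phi> t \<alpha> \<beta> * (dv \<alpha> t \<bullet> (dv \<beta> t /\<^sub>R T \<beta> t - dv \<alpha> t /\<^sub>R T \<alpha> t)))
      \<le> real CARD('n) * (\<phi> 0 * K / 2 - p / U) * \<V> t"
    by (simp add: norm_minus_commute)
  also have "\<dots> \<le> real CARD('n) * (- (p / (2 * U))) * \<V> t"
  proof (intro mult_right_mono mult_left_mono)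
    have "2 * U * (\<phi> 0 / ((\<delta> - 1) * L)) \<le> p" using coercive by (simp add: U_def L_def p_def)
    then have "\<phi> 0 / ((\<delta> - 1) * L) \<le> p / (2 * U)" using U_pos by (simp add: pos_le_divide_eq mult_ac)
    moreover have "\<phi> 0 * K / 2 = \<phi> 0 / ((\<delta> - 1) * L)" by (simp add: K_def)
    moreover have "p / U = p / (2 * U) + p / (2 * U)" by simp
    ultimately show "\<phi> 0 * K / 2 - p / U \<le> - (p / (2 * U))" by linarith
  qed (auto intro: sum_nonneg)
  finally have "\<kappa>1 / real CARD('n) * (\<Sum>\<alpha>\<in>UNIV. \<Sum>\<beta>\<in>UNIV. \<Phi> t \<alpha> \<beta> * (dv \<alpha> t \<bullet> (dv \<beta> t /\<^sub>R T \<beta> t - dv \<alpha> t /\<^sub>R T \<alpha> t)))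
      \<le> \<kappa>1 / real CARD('n) * (real CARD('n) * (- (p / (2 * U))) * \<V> t)"
    using kappa_pos by (intro mult_left_mono) auto
  moreover have "(\<Sum>\<alpha>\<in>UNIV. dv \<alpha> t \<bullet> F \<alpha> t) = \<kappa>1 / real CARD('n) *
      (\<Sum>\<alpha>\<in>UNIV. \<Sum>\<beta>\<in>UNIV. \<Phi> t \<alpha> \<beta> * (dv \<alpha> t \<bullet> (dv \<beta> t /\<^sub>R T \<beta> t - dv \<alpha> t /\<^sub>R T \<alpha> t)))"
    by (simp only: coupling_eq inner_scaleR_right inner_sum_right flip: sum_distrib_left)
  ultimately show ?thesis by simp
qed

lemma coupling_force_bound:
  assumes "confined t"
  shows "(\<Sum>\<alpha>\<in>UNIV. (norm (F \<alpha> t))\<^sup>2) \<le> 2 * (\<kappa>1 * \<phi> 0)\<^sup>2 / L\<^sup>2 * \<V> t"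
proof -
  have t: "0 \<le> t" and c: "temp_fluct v T t \<le> \<epsilon>0" "fluct x t \<le> 3 * \<epsilon>0"
    using assms by (auto simp: confined_def)
  note tb = temperature_bounds[OF t c(1)]
  define w where "w \<alpha> = dv \<alpha> t /\<^sub>R T \<alpha> t" for \<alpha>
  have "(norm (w \<alpha>))\<^sup>2 \<le> 1 / L\<^sup>2 * (norm (dv \<alpha> t))\<^sup>2" for \<alpha>
  proof -
    have "inverse (T \<alpha> t) \<le> 1 / L" using tb(2)[of \<alpha>] L_pos by (simp add: inverse_eq_divide frac_le)
    then have "(inverse (T \<alpha> t))\<^sup>2 \<le> (1 / L)\<^sup>2"
      using tb(2)[of \<alpha>] L_pos by (intro power_mono) auto
    then have "(inverse (T \<alpha> t))\<^sup>2 * (norm (dv \<alpha> t))\<^sup>2 \<le> (1 / L)\<^sup>2 * (norm (dv \<alpha> t))\<^sup>2"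
      by (intro mult_right_mono) auto
    then show ?thesis by (simp add: w_def power_mult_distrib power_divide power_inverse)
  qed
  then have w: "(\<Sum>\<alpha>\<in>UNIV. (norm (w \<alpha>))\<^sup>2) \<le> 1 / L\<^sup>2 * \<V> t"
    unfolding sum_distrib_left by (intro sum_mono)
  have "(\<Sum>\<alpha>\<in>UNIV. (norm (F \<alpha> t))\<^sup>2)
      = (\<kappa>1 / real CARD('n))\<^sup>2 * (\<Sum>\<alpha>\<in>UNIV. (norm (\<Sum>\<beta>\<in>UNIV. \<Phi> t \<alpha> \<beta> *\<^sub>R (w \<beta> - w \<alpha>)))\<^sup>2)"
    by (simp add: coupling_eq w_def power_mult_distrib power_divide sum_distrib_left)
  also have "\<dots> \<le> (\<kappa>1 / real CARD('n))\<^sup>2 * (2 * (real CARD('n) * \<phi> 0)\<^sup>2 * (\<Sum>\<alpha>\<in>UNIV. (norm (w \<alpha>))\<^sup>2))"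
    using weight_bounds(2)[OF c(2)] weights_nonneg by (intro mult_left_mono coupling_norm_bound) auto
  also have "\<dots> = 2 * (\<kappa>1 * \<phi> 0)\<^sup>2 * (\<Sum>\<alpha>\<in>UNIV. (norm (w \<alpha>))\<^sup>2)"
    by (simp add: power_mult_distrib power_divide)
  also have "\<dots> \<le> 2 * (\<kappa>1 * \<phi> 0)\<^sup>2 * (1 / L\<^sup>2 * \<V> t)"
    by (intro mult_left_mono w) auto
  finally show ?thesis by simp
qed

text \<open>
  The Lyapunov functional: oscillator energy of the deviations, perturbed by a cross term. The energy
  alone is not dissipated when \<open>dv = 0\<close>.
\<close>

definition E :: "real \<Rightarrow> real" where
  "E t = (\<Sum>\<alpha>\<in>UNIV. 1/2 * (norm (dx \<alpha> t))\<^sup>2 + 1/2 * (norm (dv \<alpha> t))\<^sup>2 + \<epsilon> * (dx \<alpha> t \<bullet> dv \<alpha> t))"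

definition E' :: "real \<Rightarrow> real" where
  "E' t = (\<Sum>\<alpha>\<in>UNIV. dv \<alpha> t \<bullet> F \<alpha> t) + \<epsilon> * (\<V> t - \<X> t + (\<Sum>\<alpha>\<in>UNIV. dx \<alpha> t \<bullet> F \<alpha> t))"

lemma E_deriv:
  assumes "0 \<le> t"
  shows "(E has_real_derivative E' t) (at t within {0..})"
proof -
  have "(E has_real_derivative (\<Sum>\<alpha>\<in>UNIV. 1/2 * (2 * (dx \<alpha> t \<bullet> dv \<alpha> t)) + 1/2 * (2 * (dv \<alpha> t \<bullet> (F \<alpha> t - dx \<alpha> t)))
      + \<epsilon> * (dx \<alpha> t \<bullet> (F \<alpha> t - dx \<alpha> t) + dv \<alpha> t \<bullet> dv \<alpha> t))) (at t within {0..})"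
    unfolding E_def[abs_def]
    by (intro DERIV_sum DERIV_add DERIV_cmult has_real_derivative_norm_squared
        has_real_derivative_inner dx_deriv dv_deriv assms)
  also have "(\<Sum>\<alpha>\<in>UNIV. 1/2 * (2 * (dx \<alpha> t \<bullet> dv \<alpha> t)) + 1/2 * (2 * (dv \<alpha> t \<bullet> (F \<alpha> t - dx \<alpha> t)))
      + \<epsilon> * (dx \<alpha> t \<bullet> (F \<alpha> t - dx \<alpha> t) + dv \<alpha> t \<bullet> dv \<alpha> t))
      = (\<Sum>\<alpha>\<in>UNIV. dv \<alpha> t \<bullet> F \<alpha> t
        + \<epsilon> * ((norm (dv \<alpha> t))\<^sup>2 - (norm (dx \<alpha> t))\<^sup>2 + dx \<alpha> t \<bullet> F \<alpha> t))"
    by (intro sum.cong refl)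
      (simp add: power2_norm_eq_inner inner_diff_right inner_commute algebra_simps diff_divide_distrib)
  also have "\<dots> = E' t"
    by (simp only: E'_def sum.distrib sum_subtractf flip: sum_distrib_left)
  finally show ?thesis .
qed

text \<open>
  The condition \<open>\<epsilon> \<le> 1/2\<close> makes the cross term at most half of the energy.
\<close>

lemma E_equivalent: "\<X> t + \<V> t \<le> 4 * E t" "E t \<le> 3/4 * (\<X> t + \<V> t)"
proof -
  have pt: "\<bar>\<epsilon> * (dx \<alpha> t \<bullet> dv \<alpha> t)\<bar> \<le> 1/4 * ((norm (dx \<alpha> t))\<^sup>2 + (norm (dv \<alpha> t))\<^sup>2)" for \<alpha>
  proof -
    have "\<bar>dx \<alpha> t \<bullet> dv \<alpha> t\<bar> \<le> norm (dx \<alpha> t) * norm (dv \<alpha> t)" by (rule Cauchy_Schwarz_ineq2)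
    also have "\<dots> \<le> 1/2 * ((norm (dx \<alpha> t))\<^sup>2 + (norm (dv \<alpha> t))\<^sup>2)"
      using sum_squares_bound[of "norm (dx \<alpha> t)" "norm (dv \<alpha> t)"] by simp
    finally have "\<epsilon> * \<bar>dx \<alpha> t \<bullet> dv \<alpha> t\<bar> \<le> 1/2 * (1/2 * ((norm (dx \<alpha> t))\<^sup>2 + (norm (dv \<alpha> t))\<^sup>2))"
      using eps by (intro mult_mono) auto
    then show ?thesis using eps by (simp add: abs_mult)
  qed
  have ar: "1/4 * (a + b) \<le> 1/2 * a + 1/2 * b + y" "1/2 * a + 1/2 * b + y \<le> 3/4 * (a + b)"
    if "\<bar>y\<bar> \<le> 1/4 * (a + b)" for a b y :: real
    using that by auto
  have "1/4 * (\<X> t + \<V> t) = (\<Sum>\<alpha>\<in>UNIV. 1/4 * ((norm (dx \<alpha> t))\<^sup>2 + (norm (dv \<alpha> t))\<^sup>2))"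
    by (simp only: sum.distrib flip: sum_distrib_left)
  also have "\<dots> \<le> E t"
    unfolding E_def
    by (intro sum_mono ar pt)
  finally show "\<X> t + \<V> t \<le> 4 * E t" by simp
  have "E t \<le> (\<Sum>\<alpha>\<in>UNIV. 3/4 * ((norm (dx \<alpha> t))\<^sup>2 + (norm (dv \<alpha> t))\<^sup>2))"
    unfolding E_def
    by (intro sum_mono ar pt)
  then show "E t \<le> 3/4 * (\<X> t + \<V> t)"
    by (simp only: sum.distrib flip: sum_distrib_left)
qed

text \<open>
  The cross term yields \<open>\<epsilon> * (V - X)\<close> together with \<open>\<epsilon> * (\<Sum> dx \<bullet> F)\<close>, and Young's inequality trades the latter for
  \<open>\<epsilon> * X / 2\<close> and a multiple of \<open>V\<close>. The damping absorbs all multiples of \<open>V\<close> and still leaves \<open>- \<epsilon> * V\<close>, so the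
  functional decreases at least like \<open>\<epsilon> / 2 * (X + V)\<close>, which is at least \<open>2 * \<epsilon> / 3\<close> times the functional.
\<close>

lemma E_dissipation:
  assumes "confined t"
  shows "E' t \<le> - (2 * \<epsilon> / 3) * E t"
proof -
  define G where "G = (\<kappa>1 * \<phi> 0)\<^sup>2 / L\<^sup>2"
  have V0: "0 \<le> \<V> t" and X0: "0 \<le> \<X> t" by (simp_all add: sum_nonneg)
  have "(\<Sum>\<alpha>\<in>UNIV. dx \<alpha> t \<bullet> F \<alpha> t) \<le> (\<Sum>\<alpha>\<in>UNIV. 1/2 * (norm (dx \<alpha> t))\<^sup>2 + 1/2 * (norm (F \<alpha> t))\<^sup>2)"
  proof (rule sum_mono)
    fix \<alpha>
    have "dx \<alpha> t \<bullet> F \<alpha> t \<le> norm (dx \<alpha> t) * norm (F \<alpha> t)" by (rule norm_cauchy_schwarz)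
    then show "dx \<alpha> t \<bullet> F \<alpha> t \<le> 1/2 * (norm (dx \<alpha> t))\<^sup>2 + 1/2 * (norm (F \<alpha> t))\<^sup>2"
      using sum_squares_bound[of "norm (dx \<alpha> t)" "norm (F \<alpha> t)"] by linarith
  qed
  also have "\<dots> = 1/2 * \<X> t + 1/2 * (\<Sum>\<alpha>\<in>UNIV. (norm (F \<alpha> t))\<^sup>2)"
    by (simp only: sum.distrib sum_distrib_left)
  also have "\<dots> \<le> 1/2 * \<X> t + G * \<V> t"
    using coupling_force_bound[OF assms] by (simp add: G_def mult_ac)
  finally have "\<epsilon> * (\<V> t - \<X> t + (\<Sum>\<alpha>\<in>UNIV. dx \<alpha> t \<bullet> F \<alpha> t)) \<le> \<epsilon> * (\<V> t - \<X> t + (1/2 * \<X> t + G * \<V> t))"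
    using eps by (intro mult_left_mono) auto
  moreover have "\<epsilon> * (2 + 3 * G) * \<V> t \<le> \<kappa>1 / (2 * U) * p * \<V> t"
    using fast V0 by (intro mult_right_mono) (simp_all add: G_def L_def U_def p_def)
  moreover have "0 \<le> \<epsilon> * G * \<V> t" using eps V0 by (simp add: G_def)
  ultimately have "E' t \<le> - \<epsilon> * \<V> t - \<epsilon> / 2 * \<X> t"
    unfolding E'_def using alignment_dissipation[OF assms] by (simp add: algebra_simps)
  also have "\<dots> \<le> - (\<epsilon> / 2 * (\<X> t + \<V> t))" using eps V0 by (simp add: algebra_simps)
  also have "\<dots> \<le> - (\<epsilon> / 2 * (4 / 3 * E t))"
    using E_equivalent(2)[of t] eps by (simp add: mult_left_mono)
  finally show ?thesis by simp
qed

text \<open>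
  The factor \<open>3\<close> is the ratio of the two constants in \<open>E_equivalent\<close>.
\<close>

lemma flocking_decay:
  assumes "0 \<le> b" and conf: "\<And>s. 0 \<le> s \<Longrightarrow> s \<le> b \<Longrightarrow> confined s"
  shows "\<X> b + \<V> b \<le> 3 * (\<X> 0 + \<V> 0) * exp (- (2 * \<epsilon> / 3) * b)"
proof -
  (* No forcing: any rate different from 2 * \<epsilon> / 3 serves as the second rate in the Gronwall inequality. *)
  have "E b \<le> E 0 * exp (- (2 * \<epsilon> / 3) * b)
      + 0 / (2 * \<epsilon> / 3 - (2 * \<epsilon> / 3 + 1)) * (exp (- (2 * \<epsilon> / 3 + 1) * b) - exp (- (2 * \<epsilon> / 3) * b))"
  proof (rule exponential_gronwall[where f' = E'])
    fix s assume s: "0 \<le> s" "s \<le> b"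
    show "(E has_real_derivative E' s) (at s within {0..})" by (rule E_deriv[OF s(1)])
    show "E' s \<le> - (2 * \<epsilon> / 3) * E s + 0 * exp (- (2 * \<epsilon> / 3 + 1) * s)"
      using E_dissipation[OF conf[OF s]] by simp
  qed (use assms in auto)
  then have "E b \<le> E 0 * exp (- (2 * \<epsilon> / 3) * b)" by simp
  also have "\<dots> \<le> 3/4 * (\<X> 0 + \<V> 0) * exp (- (2 * \<epsilon> / 3) * b)"
    by (intro mult_right_mono E_equivalent) auto
  finally show ?thesis using E_equivalent(1)[of b] by simp
qed

section \<open>Decay of the temperature fluctuations\<close>

abbreviation a\<^sub>1 :: real where "a\<^sub>1 \<equiv> A1 \<kappa>1 \<kappa>2 \<phi> \<zeta> \<epsilon>0 x v T"
abbreviation a\<^sub>2 :: real where "a\<^sub>2 \<equiv> A2 \<kappa>1 \<kappa>2 \<phi> \<zeta> \<epsilon>0 x v T"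

lemma Z_norm_squared: "(Z_norm x v t)\<^sup>2 = \<X> t + \<V> t"
  by (simp add: Z_norm_def fluct_squared sum_nonneg)

lemma a\<^sub>1_eq: "a\<^sub>1 = 2 * \<kappa>2 * q / U\<^sup>2 - \<kappa>1 * \<phi> 0 / L - 1
    - 16 * \<kappa>1 * \<phi> 0 / L\<^sup>2 * (\<X> 0 + \<V> 0) - 2 * sqrt 2 * zc_norm0 x v"
  by (simp add: A1_def q_def U_def L_def Z_norm_squared)

lemma a\<^sub>2_eq: "a\<^sub>2 = 16 * (2 * \<phi> 0 * \<kappa>1 / L + \<kappa>2 * q / (2 * real CARD('n) * U\<^sup>2) + 1) * (\<X> 0 + \<V> 0)\<^sup>2
    + 4 * sqrt 2 * zc_norm0 x v * (\<X> 0 + \<V> 0)"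
proof -
  have "(Z_norm x v 0) ^ 4 = ((Z_norm x v 0)\<^sup>2)\<^sup>2" by simp
  then have "(Z_norm x v 0) ^ 4 = (\<X> 0 + \<V> 0)\<^sup>2" by (simp only: Z_norm_squared)
  then show ?thesis by (simp add: A2_def q_def U_def L_def Z_norm_squared)
qed

lemma zc_norm0_nonneg: "0 \<le> zc_norm0 x v" by (simp add: zc_norm0_def)

lemma a\<^sub>2_nonneg: "0 \<le> a\<^sub>2"
  unfolding a\<^sub>2_eq using kappa_pos weight_values_nonneg L_pos zc_norm0_nonneg
  by (intro add_nonneg_nonneg mult_nonneg_nonneg divide_nonneg_nonneg sum_nonneg) auto

definition \<T>' :: "real \<Rightarrow> real" where
  "\<T>' t = 2 * \<kappa>2 / real CARD('n) * (\<Sum>\<alpha>\<in>UNIV. \<Sum>\<beta>\<in>UNIV. Z t \<alpha> \<beta> * (dT \<alpha> t * (1 / T \<alpha> t - 1 / T \<beta> t)))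
    + \<kappa>1 / real CARD('n) * (2 * (\<Sum>\<alpha>\<in>UNIV. \<Sum>\<beta>\<in>UNIV. \<Phi> t \<alpha> \<beta> *
        (dT \<alpha> t * (dv \<alpha> t \<bullet> (dv \<alpha> t /\<^sub>R T \<alpha> t - dv \<beta> t /\<^sub>R T \<beta> t)))))
    + (\<Sum>\<alpha>\<in>UNIV. 2 * (dT \<alpha> t * (dx \<alpha> t \<bullet> dv \<alpha> t)))
    + (\<Sum>\<alpha>\<in>UNIV. 2 * (dT \<alpha> t * (dx \<alpha> t \<bullet> center v t + center x t \<bullet> dv \<alpha> t)))"

lemma \<T>_deriv:
  assumes "0 \<le> t"
  shows "(\<T> has_real_derivative \<T>' t) (at t within {0..})"
proof -
  let ?R = "\<lambda>\<alpha>. \<Sum>\<beta>\<in>UNIV. Z t \<alpha> \<beta> * (1 / T \<alpha> t - 1 / T \<beta> t)"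
  let ?Q = "\<lambda>\<alpha>. \<Sum>\<beta>\<in>UNIV. \<Phi> t \<alpha> \<beta> * (dv \<alpha> t \<bullet> (dv \<alpha> t /\<^sub>R T \<alpha> t - dv \<beta> t /\<^sub>R T \<beta> t))"
  let ?D = "\<lambda>\<alpha>. \<kappa>2 / real CARD('n) * ?R \<alpha> - F \<alpha> t \<bullet> dv \<alpha> t + dx \<alpha> t \<bullet> dv \<alpha> t
    + (dx \<alpha> t \<bullet> center v t + center x t \<bullet> dv \<alpha> t)"
  have F: "F \<alpha> t \<bullet> dv \<alpha> t = - (\<kappa>1 / real CARD('n) * ?Q \<alpha>)" for \<alpha>
  proof -
    have "F \<alpha> t \<bullet> dv \<alpha> t = \<kappa>1 / real CARD('n) *
        (\<Sum>\<beta>\<in>UNIV. \<Phi> t \<alpha> \<beta> * (dv \<alpha> t \<bullet> (dv \<beta> t /\<^sub>R T \<beta> t - dv \<alpha> t /\<^sub>R T \<alpha> t)))"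
      by (simp only: coupling_eq inner_commute[of _ "dv \<alpha> t"] inner_scaleR_right inner_sum_right)
    also have "(\<Sum>\<beta>\<in>UNIV. \<Phi> t \<alpha> \<beta> * (dv \<alpha> t \<bullet> (dv \<beta> t /\<^sub>R T \<beta> t - dv \<alpha> t /\<^sub>R T \<alpha> t))) = - ?Q \<alpha>"
      unfolding sum_negf[symmetric] by (intro sum.cong refl) (simp add: inner_diff_right algebra_simps)
    finally show ?thesis by simp
  qed
  have "(\<T> has_real_derivative (\<Sum>\<alpha>\<in>UNIV. 2 * (dT \<alpha> t * ?D \<alpha>))) (at t within {0..})"
  proof (rule DERIV_sum)
    fix \<alpha>
    show "((\<lambda>s. (dT \<alpha> s)\<^sup>2) has_real_derivative 2 * (dT \<alpha> t * ?D \<alpha>)) (at t within {0..})"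
      using DERIV_power[OF dT_deriv[OF assms], where n = 2] by (simp add: mult_ac)
  qed
  also have "(\<Sum>\<alpha>\<in>UNIV. 2 * (dT \<alpha> t * ?D \<alpha>))
      = (\<Sum>\<alpha>\<in>UNIV. 2 * \<kappa>2 / real CARD('n) * (dT \<alpha> t * ?R \<alpha>)
        + \<kappa>1 / real CARD('n) * (2 * (dT \<alpha> t * ?Q \<alpha>))
        + 2 * (dT \<alpha> t * (dx \<alpha> t \<bullet> dv \<alpha> t))
        + 2 * (dT \<alpha> t * (dx \<alpha> t \<bullet> center v t + center x t \<bullet> dv \<alpha> t)))"
    by (intro sum.cong refl) (simp add: F distrib_left mult_ac)
  also have "\<dots> = 2 * \<kappa>2 / real CARD('n) * (\<Sum>\<alpha>\<in>UNIV. dT \<alpha> t * ?R \<alpha>)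
        + \<kappa>1 / real CARD('n) * (2 * (\<Sum>\<alpha>\<in>UNIV. dT \<alpha> t * ?Q \<alpha>))
        + (\<Sum>\<alpha>\<in>UNIV. 2 * (dT \<alpha> t * (dx \<alpha> t \<bullet> dv \<alpha> t)))
        + (\<Sum>\<alpha>\<in>UNIV. 2 * (dT \<alpha> t * (dx \<alpha> t \<bullet> center v t + center x t \<bullet> dv \<alpha> t)))"
    by (simp only: sum.distrib sum_distrib_left)
  also have "\<dots> = \<T>' t"
    unfolding \<T>'_def by (simp only: sum_distrib_left mult.left_commute)
  finally show ?thesis .
qed

text \<open>
  One estimate for each part of \<open>\<T>'\<close>. In the drift term,
  \<open>dx \<bullet> center v + center x \<bullet> dv\<close> is the inner product of \<open>(dx, dv)\<close> with \<open>(center v, center x)\<close>, and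
  the norm of the latter pair is the conserved \<open>zc_norm0\<close>.
\<close>

lemma \<T>_dissipation:
  assumes "confined t"
  shows "\<T>' t \<le> - 2 * \<kappa>2 * q / U\<^sup>2 * \<T> t + \<kappa>2 * q / (2 * real CARD('n) * U\<^sup>2) * (\<V> t)\<^sup>2
    + \<kappa>1 * \<phi> 0 / L * (\<T> t + 2 * (\<V> t)\<^sup>2) + 2 * \<kappa>1 * \<phi> 0 / L\<^sup>2 * (\<V> t * \<T> t)
    + (\<T> t + \<X> t * \<V> t) + zc_norm0 x v * (\<T> t + (\<X> t + \<V> t))"
proof -
  have t: "0 \<le> t" and c: "temp_fluct v T t \<le> \<epsilon>0" "fluct x t \<le> 3 * \<epsilon>0"
    using assms by (auto simp: confined_def)
  note tb = temperature_bounds[OF t c(1)]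
  note wb = weight_bounds[OF c(2)]
  have T: "T \<alpha> t = T_inf v T t + dT \<alpha> t" for \<alpha> by (simp add: dT_def)
  let ?z = "zc_norm0 x v"
  have "(\<Sum>\<alpha>\<in>UNIV. \<Sum>\<beta>\<in>UNIV. Z t \<alpha> \<beta> * (dT \<alpha> t * (1 / T \<alpha> t - 1 / T \<beta> t)))
      \<le> - q / U\<^sup>2 * (real CARD('n) * \<T> t - (\<Sum>\<alpha>\<in>UNIV. dT \<alpha> t)\<^sup>2)"
    unfolding T
    using tb(2,3) L_pos wb(3) weight_values_nonneg
    by (intro temperature_relaxation) (auto simp: norm_minus_commute order_less_le_trans simp flip: T)
  then have "2 * \<kappa>2 / real CARD('n) * (\<Sum>\<alpha>\<in>UNIV. \<Sum>\<beta>\<in>UNIV. Z t \<alpha> \<beta> * (dT \<alpha> t * (1 / T \<alpha> t - 1 / T \<beta> t)))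
      \<le> 2 * \<kappa>2 / real CARD('n) * (- q / U\<^sup>2 * (real CARD('n) * \<T> t - (\<Sum>\<alpha>\<in>UNIV. dT \<alpha> t)\<^sup>2))"
    using kappa_pos by (intro mult_left_mono) auto
  also have "\<dots> = - 2 * \<kappa>2 * q / U\<^sup>2 * \<T> t + \<kappa>2 * q / (2 * real CARD('n) * U\<^sup>2) * (\<V> t)\<^sup>2"
  proof -
    have sq: "(\<Sum>\<alpha>\<in>UNIV. dT \<alpha> t)\<^sup>2 = (\<V> t)\<^sup>2 / 4" by (simp add: sum_dT[OF t] power_divide)
    show ?thesis unfolding sq by (simp add: right_diff_distrib mult_ac)
  qed
  finally have relax: "2 * \<kappa>2 / real CARD('n) *
      (\<Sum>\<alpha>\<in>UNIV. \<Sum>\<beta>\<in>UNIV. Z t \<alpha> \<beta> * (dT \<alpha> t * (1 / T \<alpha> t - 1 / T \<beta> t)))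
      \<le> - 2 * \<kappa>2 * q / U\<^sup>2 * \<T> t + \<kappa>2 * q / (2 * real CARD('n) * U\<^sup>2) * (\<V> t)\<^sup>2" .
  have "2 * (\<Sum>\<alpha>\<in>UNIV. \<Sum>\<beta>\<in>UNIV. \<Phi> t \<alpha> \<beta> *
        (dT \<alpha> t * (dv \<alpha> t \<bullet> (dv \<alpha> t /\<^sub>R T \<alpha> t - dv \<beta> t /\<^sub>R T \<beta> t))))
      \<le> real CARD('n) * (\<phi> 0 / L * (\<T> t + 2 * (\<V> t)\<^sup>2) + 2 * \<phi> 0 / L\<^sup>2 * (\<V> t * \<T> t))"
    unfolding T
    using tb(2,4) L_pos wb(2) weights_nonneg
    by (intro collisional_heating sum_dv_eq_0) (auto simp flip: T)
  then have "\<kappa>1 / real CARD('n) * (2 * (\<Sum>\<alpha>\<in>UNIV. \<Sum>\<beta>\<in>UNIV. \<Phi> t \<alpha> \<beta> *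
        (dT \<alpha> t * (dv \<alpha> t \<bullet> (dv \<alpha> t /\<^sub>R T \<alpha> t - dv \<beta> t /\<^sub>R T \<beta> t)))))
      \<le> \<kappa>1 / real CARD('n) * (real CARD('n) * (\<phi> 0 / L * (\<T> t + 2 * (\<V> t)\<^sup>2) + 2 * \<phi> 0 / L\<^sup>2 * (\<V> t * \<T> t)))"
    using kappa_pos by (intro mult_left_mono) auto
  also have "\<dots> = \<kappa>1 * \<phi> 0 / L * (\<T> t + 2 * (\<V> t)\<^sup>2) + 2 * \<kappa>1 * \<phi> 0 / L\<^sup>2 * (\<V> t * \<T> t)"
    by (simp add: distrib_left mult_ac)
  finally have heat: "\<kappa>1 / real CARD('n) * (2 * (\<Sum>\<alpha>\<in>UNIV. \<Sum>\<beta>\<in>UNIV. \<Phi> t \<alpha> \<beta> *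
        (dT \<alpha> t * (dv \<alpha> t \<bullet> (dv \<alpha> t /\<^sub>R T \<alpha> t - dv \<beta> t /\<^sub>R T \<beta> t)))))
      \<le> \<kappa>1 * \<phi> 0 / L * (\<T> t + 2 * (\<V> t)\<^sup>2) + 2 * \<kappa>1 * \<phi> 0 / L\<^sup>2 * (\<V> t * \<T> t)" .
  have work: "(\<Sum>\<alpha>\<in>UNIV. 2 * (dT \<alpha> t * (dx \<alpha> t \<bullet> dv \<alpha> t))) \<le> \<T> t + \<X> t * \<V> t"
  proof -
    have "(\<Sum>\<alpha>\<in>UNIV. 2 * (dT \<alpha> t * (dx \<alpha> t \<bullet> dv \<alpha> t)))
        \<le> (\<Sum>\<alpha>\<in>UNIV. (dT \<alpha> t)\<^sup>2 + (norm (dx \<alpha> t))\<^sup>2 * \<V> t)"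
    proof (rule sum_mono)
      fix \<alpha>
      have "2 * (dT \<alpha> t * (dx \<alpha> t \<bullet> dv \<alpha> t)) \<le> (dT \<alpha> t)\<^sup>2 + (dx \<alpha> t \<bullet> dv \<alpha> t)\<^sup>2"
        using sum_squares_bound[of "dT \<alpha> t" "dx \<alpha> t \<bullet> dv \<alpha> t"] by simp
      also have "(dx \<alpha> t \<bullet> dv \<alpha> t)\<^sup>2 \<le> (norm (dx \<alpha> t))\<^sup>2 * (norm (dv \<alpha> t))\<^sup>2"
        using Cauchy_Schwarz_ineq[of "dx \<alpha> t" "dv \<alpha> t"] by (simp add: power2_norm_eq_inner)
      also have "\<dots> \<le> (norm (dx \<alpha> t))\<^sup>2 * \<V> t"
        by (intro mult_left_mono member_le_sum[of \<alpha> UNIV "\<lambda>\<alpha>. (norm (dv \<alpha> t))\<^sup>2"]) auto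
      finally show "2 * (dT \<alpha> t * (dx \<alpha> t \<bullet> dv \<alpha> t)) \<le> (dT \<alpha> t)\<^sup>2 + (norm (dx \<alpha> t))\<^sup>2 * \<V> t"
        by simp
    qed
    then show ?thesis by (simp add: sum.distrib flip: sum_distrib_right)
  qed
  have drift: "(\<Sum>\<alpha>\<in>UNIV. 2 * (dT \<alpha> t * (dx \<alpha> t \<bullet> center v t + center x t \<bullet> dv \<alpha> t)))
      \<le> ?z * (\<T> t + (\<X> t + \<V> t))"
  proof -
    have "(\<Sum>\<alpha>\<in>UNIV. 2 * (dT \<alpha> t * (dx \<alpha> t \<bullet> center v t + center x t \<bullet> dv \<alpha> t)))
        \<le> (\<Sum>\<alpha>\<in>UNIV. ?z * ((dT \<alpha> t)\<^sup>2 + ((norm (dx \<alpha> t))\<^sup>2 + (norm (dv \<alpha> t))\<^sup>2)))"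
    proof (rule sum_mono)
      fix \<alpha>
      have "dx \<alpha> t \<bullet> center v t + center x t \<bullet> dv \<alpha> t = (dx \<alpha> t, dv \<alpha> t) \<bullet> (center v t, center x t)"
        by (simp add: inner_commute)
      then have "\<bar>dx \<alpha> t \<bullet> center v t + center x t \<bullet> dv \<alpha> t\<bar>
          \<le> norm (dx \<alpha> t, dv \<alpha> t) * norm (center v t, center x t)"
        using Cauchy_Schwarz_ineq2[of "(dx \<alpha> t, dv \<alpha> t)" "(center v t, center x t)"] by simp
      also have "norm (center v t, center x t) = ?z"
        using center_oscillation_energy[OF t] zc_norm0_nonneg by (simp add: norm_Pair)
      finally have "\<bar>dT \<alpha> t\<bar> * \<bar>dx \<alpha> t \<bullet> center v t + center x t \<bullet> dv \<alpha> t\<bar>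
          \<le> \<bar>dT \<alpha> t\<bar> * (norm (dx \<alpha> t, dv \<alpha> t) * ?z)"
        by (intro mult_left_mono) auto
      then have "2 * (dT \<alpha> t * (dx \<alpha> t \<bullet> center v t + center x t \<bullet> dv \<alpha> t))
          \<le> ?z * (2 * \<bar>dT \<alpha> t\<bar> * norm (dx \<alpha> t, dv \<alpha> t))"
        using abs_ge_self[of "dT \<alpha> t * (dx \<alpha> t \<bullet> center v t + center x t \<bullet> dv \<alpha> t)"]
        unfolding abs_mult by (simp add: mult_ac)
      also have "\<dots> \<le> ?z * (\<bar>dT \<alpha> t\<bar>\<^sup>2 + (norm (dx \<alpha> t, dv \<alpha> t))\<^sup>2)"
        by (intro mult_left_mono sum_squares_bound zc_norm0_nonneg)
      also have "(norm (dx \<alpha> t, dv \<alpha> t))\<^sup>2 = (norm (dx \<alpha> t))\<^sup>2 + (norm (dv \<alpha> t))\<^sup>2"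
        by (simp add: norm_Pair)
      finally show "2 * (dT \<alpha> t * (dx \<alpha> t \<bullet> center v t + center x t \<bullet> dv \<alpha> t))
          \<le> ?z * ((dT \<alpha> t)\<^sup>2 + ((norm (dx \<alpha> t))\<^sup>2 + (norm (dv \<alpha> t))\<^sup>2))"
        by simp
    qed
    then show ?thesis by (simp only: sum.distrib flip: sum_distrib_left)
  qed
  show ?thesis unfolding \<T>'_def using add_mono[OF add_mono[OF add_mono[OF relax heat] work] drift]
    by (simp only: add.assoc)
qed

text \<open>
  It remains to insert the decay of \<open>X + V\<close> and to compare with \<open>A1\<close> and \<open>A2\<close>. Products such as \<open>V\<^sup>2\<close>
  decay at twice the rate; one of the two exponential factors is estimated by \<open>1\<close>, so that all forcing
  terms share the slowest rate \<open>2 * \<epsilon> / 3\<close>.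
\<close>

lemma \<T>_differential_inequality:
  assumes "confined t" and Z: "\<X> t + \<V> t \<le> 4 * (\<X> 0 + \<V> 0) * exp (- (2 * \<epsilon> / 3) * t)"
  shows "\<T>' t \<le> - a\<^sub>1 * \<T> t + a\<^sub>2 * exp (- (2 * \<epsilon> / 3) * t)"
proof -
  define e where "e = exp (- (2 * \<epsilon> / 3) * t)"
  define z0 where "z0 = \<X> 0 + \<V> 0"
  define k where "k = \<kappa>1 * \<phi> 0"
  define c where "c = \<kappa>2 * q / (2 * real CARD('n) * U\<^sup>2)"
  define z where "z = zc_norm0 x v"
  have "0 \<le> t" using assms(1) by (simp add: confined_def)
  then have e: "0 < e" "e \<le> 1" using eps by (simp_all add: e_def)
  have X0: "0 \<le> \<X> t" and V0: "0 \<le> \<V> t" and T0: "0 \<le> \<T> t" and z0: "0 \<le> z0"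
    by (simp_all add: z0_def sum_nonneg)
  have k: "0 \<le> k" and c: "0 \<le> c" and z: "0 \<le> z"
    using kappa_pos weight_values_nonneg zc_norm0_nonneg by (simp_all add: k_def c_def z_def)
  have "1 \<le> sqrt 2" by simp
  have V: "\<V> t \<le> 4 * z0 * e" and XV: "\<X> t + \<V> t \<le> 4 * z0 * e"
    using Z X0 by (simp_all add: e_def z0_def)
  have "\<V> t \<le> 8 * z0"
    using V mult_left_mono[OF e(2), of "4 * z0"] z0 by simp
  then have b1: "2 * k / L\<^sup>2 * (\<V> t * \<T> t) \<le> 16 * k / L\<^sup>2 * z0 * \<T> t"
    using mult_left_mono[OF mult_right_mono[OF _ T0], of "\<V> t" "8 * z0" "2 * k / L\<^sup>2"] k
    by (simp add: mult_ac)
  have sq: "y\<^sup>2 \<le> 16 * z0\<^sup>2 * e" if "0 \<le> y" "y \<le> 4 * z0 * e" for y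
  proof -
    have "y\<^sup>2 \<le> (4 * z0 * e)\<^sup>2" using that by (intro power_mono)
    also have "\<dots> = 16 * z0\<^sup>2 * e * e" by (simp add: power2_eq_square)
    also have "\<dots> \<le> 16 * z0\<^sup>2 * e * 1" using e by (intro mult_left_mono) auto
    finally show ?thesis by simp
  qed
  have V2: "(\<V> t)\<^sup>2 \<le> 16 * z0\<^sup>2 * e" using sq V V0 by blast
  have "\<X> t * \<V> t \<le> (\<X> t + \<V> t)\<^sup>2"
    using X0 V0 by (simp add: power2_eq_square algebra_simps)
  also have "\<dots> \<le> 16 * z0\<^sup>2 * e" using sq XV X0 V0 by simp
  finally have b2: "\<X> t * \<V> t \<le> 16 * z0\<^sup>2 * e" .
  have b3: "c * (\<V> t)\<^sup>2 \<le> c * (16 * z0\<^sup>2 * e)" using V2 c by (rule mult_left_mono)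
  have b4: "k / L * (2 * (\<V> t)\<^sup>2) \<le> k / L * (2 * (16 * z0\<^sup>2 * e))"
    using V2 k L_pos by (intro mult_left_mono) auto
  have b5: "z * (\<T> t + (\<X> t + \<V> t)) \<le> z * (2 * sqrt 2 * \<T> t + sqrt 2 * (4 * z0 * e))"
  proof (intro mult_left_mono add_mono z)
    have "1 * \<T> t \<le> 2 * sqrt 2 * \<T> t" using \<open>1 \<le> sqrt 2\<close> by (intro mult_right_mono T0) linarith
    then show "\<T> t \<le> 2 * sqrt 2 * \<T> t" by simp
    have "1 * (4 * z0 * e) \<le> sqrt 2 * (4 * z0 * e)"
      using \<open>1 \<le> sqrt 2\<close> e z0 by (intro mult_right_mono) auto
    then show "\<X> t + \<V> t \<le> sqrt 2 * (4 * z0 * e)" using XV by linarith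
  qed
  have "\<T>' t \<le> - 2 * \<kappa>2 * q / U\<^sup>2 * \<T> t + c * (\<V> t)\<^sup>2 + k / L * \<T> t + k / L * (2 * (\<V> t)\<^sup>2)
      + 2 * k / L\<^sup>2 * (\<V> t * \<T> t) + (\<T> t + \<X> t * \<V> t) + z * (\<T> t + (\<X> t + \<V> t))"
    using \<T>_dissipation[OF assms(1)] by (simp add: k_def c_def z_def distrib_left add.assoc)
  also have "\<dots> \<le> - 2 * \<kappa>2 * q / U\<^sup>2 * \<T> t + c * (16 * z0\<^sup>2 * e) + k / L * \<T> t + k / L * (2 * (16 * z0\<^sup>2 * e))
      + 16 * k / L\<^sup>2 * z0 * \<T> t + (\<T> t + 16 * z0\<^sup>2 * e) + z * (2 * sqrt 2 * \<T> t + sqrt 2 * (4 * z0 * e))"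
    by (intro add_mono b1 b2 b3 b4 b5 order_refl)
  also have "\<dots> = - (2 * \<kappa>2 * q / U\<^sup>2 - k / L - 1 - 16 * k / L\<^sup>2 * z0 - 2 * sqrt 2 * z) * \<T> t
      + (16 * (2 * k / L + c + 1) * z0\<^sup>2 + 4 * sqrt 2 * z * z0) * e"
    by (simp add: algebra_simps)
  also have "\<dots> = - a\<^sub>1 * \<T> t + a\<^sub>2 * e"
    unfolding a\<^sub>1_eq a\<^sub>2_eq by (simp add: k_def c_def z_def z0_def mult_ac)
  finally show ?thesis unfolding e_def .
qed

lemma temperature_decay:
  assumes "0 \<le> b" and conf: "\<And>s. 0 \<le> s \<Longrightarrow> s \<le> b \<Longrightarrow> confined s" and "a\<^sub>1 \<noteq> 2 * \<epsilon> / 3"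
  shows "\<T> b \<le> \<T> 0 * exp (- a\<^sub>1 * b)
    + a\<^sub>2 / (a\<^sub>1 - 2 * \<epsilon> / 3) * (exp (- (2 * \<epsilon> / 3) * b) - exp (- a\<^sub>1 * b))"
proof (rule exponential_gronwall[where f' = \<T>'])
  fix s assume s: "0 \<le> s" "s \<le> b"
  show "(\<T> has_real_derivative \<T>' s) (at s within {0..})" by (rule \<T>_deriv[OF s(1)])
  have "\<X> s + \<V> s \<le> 3 * (\<X> 0 + \<V> 0) * exp (- (2 * \<epsilon> / 3) * s)"
    using s conf by (intro flocking_decay) auto
  also have "\<dots> \<le> 4 * (\<X> 0 + \<V> 0) * exp (- (2 * \<epsilon> / 3) * s)"
    by (intro mult_right_mono) (auto intro!: add_nonneg_nonneg sum_nonneg)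
  finally show "\<T>' s \<le> - a\<^sub>1 * \<T> s + a\<^sub>2 * exp (- (2 * \<epsilon> / 3) * s)"
    by (intro \<T>_differential_inequality conf s)
qed (use assms in auto)

section \<open>Confinement for all times\<close>

text \<open>
  Confinement is the condition \<open>f \<le> 0\<close> for a continuous scalar function \<open>f\<close>. On a confined time interval
  the decay estimates give \<open>X \<le> 3 * (X 0 + V 0) \<le> 6 * \<epsilon>0\<^sup>2\<close>, and the assumption \<open>small\<close> gives \<open>H < \<epsilon>0\<^sup>2\<close>
  because the difference of two exponentials in \<open>(0, 1]\<close> is at most \<open>1\<close> in absolute value.
\<close>

lemma confined_always:
  assumes init: "fluct x 0 \<le> \<epsilon>0" "fluct v 0 \<le> \<epsilon>0"
    and small: "(temp_fluct v T 0)\<^sup>2 + a\<^sub>2 / \<bar>a\<^sub>1 - 2/3 * \<epsilon>\<bar> < \<epsilon>0\<^sup>2"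
    and a\<^sub>1: "0 < a\<^sub>1" "a\<^sub>1 \<noteq> 2 * \<epsilon> / 3"
    and "0 \<le> t"
  shows "confined t"
proof -
  define f where "f s = max (\<T> s - \<epsilon>0\<^sup>2) (\<X> s - (3 * \<epsilon>0)\<^sup>2)" for s
  have T0: "0 \<le> \<T> s" and X0: "0 \<le> \<X> s" and V0: "0 \<le> \<V> s" for s by (simp_all add: sum_nonneg)
  have conf_iff: "confined s \<longleftrightarrow> f s \<le> 0" if "0 \<le> s" for s
  proof -
    have "temp_fluct v T s \<le> \<epsilon>0 \<longleftrightarrow> \<T> s \<le> \<epsilon>0\<^sup>2" "fluct x s \<le> 3 * \<epsilon>0 \<longleftrightarrow> \<X> s \<le> (3 * \<epsilon>0)\<^sup>2"
      unfolding fluct_squared[symmetric]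
      using eps0 by (intro power_mono_iff[symmetric]; simp add: temp_fluct_def fluct_def sum_nonneg)+
    then show ?thesis using that by (simp add: confined_def f_def)
  qed
  have T_small: "\<T> 0 + a\<^sub>2 / \<bar>a\<^sub>1 - 2 * \<epsilon> / 3\<bar> < \<epsilon>0\<^sup>2"
    using small by (simp add: fluct_squared)
  have frac: "0 \<le> a\<^sub>2 / \<bar>a\<^sub>1 - 2 * \<epsilon> / 3\<bar>" using a\<^sub>2_nonneg by simp
  have X_small: "\<X> 0 \<le> \<epsilon>0\<^sup>2" "\<V> 0 \<le> \<epsilon>0\<^sup>2"
    unfolding fluct_squared[symmetric] using init
    by (intro power_mono; simp add: fluct_def sum_nonneg)+
  have e2: "0 < \<epsilon>0\<^sup>2" "(3 * \<epsilon>0)\<^sup>2 = 9 * \<epsilon>0\<^sup>2" using eps0 by (simp_all add: power_mult_distrib)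
  have "f t < 0"
  proof (rule continuity_bootstrap[OF _ _ _ \<open>0 \<le> t\<close>])
    have "continuous_on {0..} (\<lambda>s. dx \<alpha> s)" for \<alpha>
      using dx_deriv by (auto intro!: continuous_on_vector_derivative[where f' = "dv \<alpha>"])
    moreover have "continuous_on {0..} (dT \<alpha>)" for \<alpha>
      by (rule DERIV_continuous_on[OF dT_deriv]) auto
    ultimately show "continuous_on {0..} f"
      unfolding f_def by (intro continuous_intros)
  next
    have "\<T> 0 < \<epsilon>0\<^sup>2" using T_small frac by linarith
    moreover have "\<X> 0 < (3 * \<epsilon>0)\<^sup>2" using X_small e2 by linarith
    ultimately show "f 0 < 0" by (simp add: f_def)
  next
    fix b :: real assume b: "0 \<le> b" and le: "\<And>s. 0 \<le> s \<Longrightarrow> s \<le> b \<Longrightarrow> f s \<le> 0"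
    have conf: "confined s" if "0 \<le> s" "s \<le> b" for s using le[OF that] conf_iff[OF that(1)] by simp
    have e1: "exp (- (2 * \<epsilon> / 3) * b) \<le> 1" "exp (- a\<^sub>1 * b) \<le> 1" using b eps a\<^sub>1 by simp_all
    have "\<X> b + \<V> b \<le> 3 * (\<X> 0 + \<V> 0) * exp (- (2 * \<epsilon> / 3) * b)"
      by (rule flocking_decay[OF b conf])
    also have "\<dots> \<le> 3 * (\<X> 0 + \<V> 0) * 1"
      using e1 X0[of 0] V0[of 0] by (intro mult_left_mono) auto
    also have "\<dots> = 3 * \<X> 0 + 3 * \<V> 0" by (simp only: distrib_left mult_1_right)
    finally have "\<X> b < (3 * \<epsilon>0)\<^sup>2" using X_small V0[of b] e2 by linarith
    moreover have "\<T> b < \<epsilon>0\<^sup>2"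
    proof -
      have "\<T> b \<le> \<T> 0 * exp (- a\<^sub>1 * b)
          + a\<^sub>2 / (a\<^sub>1 - 2 * \<epsilon> / 3) * (exp (- (2 * \<epsilon> / 3) * b) - exp (- a\<^sub>1 * b))"
        by (rule temperature_decay[OF b conf a\<^sub>1(2)])
      also have "\<T> 0 * exp (- a\<^sub>1 * b) \<le> \<T> 0 * 1" by (intro mult_left_mono e1 T0)
      also have "a\<^sub>2 / (a\<^sub>1 - 2 * \<epsilon> / 3) * (exp (- (2 * \<epsilon> / 3) * b) - exp (- a\<^sub>1 * b))
          \<le> \<bar>a\<^sub>2 / (a\<^sub>1 - 2 * \<epsilon> / 3)\<bar> * \<bar>exp (- (2 * \<epsilon> / 3) * b) - exp (- a\<^sub>1 * b)\<bar>"
        unfolding abs_mult[symmetric] by (rule abs_ge_self)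
      also have "\<dots> \<le> a\<^sub>2 / \<bar>a\<^sub>1 - 2 * \<epsilon> / 3\<bar> * 1"
      proof (intro mult_mono)
        show "\<bar>exp (- (2 * \<epsilon> / 3) * b) - exp (- a\<^sub>1 * b)\<bar> \<le> 1"
          using e1 exp_gt_zero[of "- (2 * \<epsilon> / 3) * b"] exp_gt_zero[of "- a\<^sub>1 * b"] unfolding abs_le_iff by linarith
      qed (use a\<^sub>2_nonneg in auto)
      finally show ?thesis using T_small by simp
    qed
    ultimately show "f b < 0" by (simp add: f_def)
  qed
  then show ?thesis using conf_iff[OF \<open>0 \<le> t\<close>] by simp
qed

end

section \<open>Temperature bounds, flocking and relaxation\<close>

theorem theorem5p1:
  fixes x v :: "'n::finite \<Rightarrow> real \<Rightarrow> real ^ 'd"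
    and T :: "'n \<Rightarrow> real \<Rightarrow> real"
    and \<phi> \<zeta> :: "real \<Rightarrow> real"
    and \<kappa>1 \<kappa>2 \<delta> \<epsilon>0 \<epsilon> lam gam :: real
  assumes "\<kappa>1 > 0" and "\<kappa>2 > 0"
    and "\<And>r. r \<ge> 0 \<Longrightarrow> \<phi> r \<ge> 0" and "\<And>r. r \<ge> 0 \<Longrightarrow> \<zeta> r \<ge> 0"
    and "\<exists>L. L-lipschitz_on {0..} \<phi>" and "\<exists>L. L-lipschitz_on {0..} \<zeta>"
    and "antimono_on {0..} \<phi>" and "antimono_on {0..} \<zeta>"
    and "TCS_harmonic_solution \<kappa>1 \<kappa>2 \<phi> \<zeta> x v T"
    and "T_m x v T > 0" and "T_M v T > 0"
    and "\<delta> > 3" and "\<epsilon>0 > 0"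
    and "A1 \<kappa>1 \<kappa>2 \<phi> \<zeta> \<epsilon>0 x v T > 0"
    and "T_m x v T \<ge> \<delta> * \<epsilon>0"
    and "fluct x 0 \<le> \<epsilon>0" and "fluct v 0 \<le> \<epsilon>0"
    and "\<epsilon>0\<^sup>2 > (temp_fluct v T 0)\<^sup>2
           + A2 \<kappa>1 \<kappa>2 \<phi> \<zeta> \<epsilon>0 x v T / \<bar>A1 \<kappa>1 \<kappa>2 \<phi> \<zeta> \<epsilon>0 x v T - 2/3 * \<epsilon>\<bar>"
    and "0 < \<epsilon>" and "\<epsilon> \<le> 1/2"
    and "\<epsilon> \<noteq> 3/2 * A1 \<kappa>1 \<kappa>2 \<phi> \<zeta> \<epsilon>0 x v T"
    and "lam = \<kappa>1 / (2 * (T_M v T + \<epsilon>0))"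
    and "gam = 3 * (\<kappa>1 * \<phi> 0)\<^sup>2 / (T_m x v T - \<epsilon>0)\<^sup>2 + 1"
    and "\<phi> (3 * sqrt 2 * \<epsilon>0) >
           max ((\<epsilon> + \<epsilon> * gam) / lam)
               (2 * (T_M v T + \<epsilon>0) * \<phi> 0 / ((\<delta> - 1) * (T_m x v T - \<epsilon>0)))"
  shows "(\<forall>\<alpha>. (SUP t\<in>{0..}. ereal \<bar>T \<alpha> t - T_inf v T t\<bar>) \<le> ereal \<epsilon>0)
    \<and> 0 < T_m x v T - \<epsilon>0
    \<and> (\<forall>\<alpha>. \<forall>t\<ge>0. T_m x v T - \<epsilon>0 \<le> T \<alpha> t \<and> T \<alpha> t \<le> T_M v T + \<epsilon>0)
    \<and> (\<forall>t\<ge>0.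
         (\<Sum>\<alpha>\<in>UNIV. (norm (x \<alpha> t - center x t))\<^sup>2 + (norm (v \<alpha> t - center v t))\<^sup>2)
         \<le> 4 * (\<Sum>\<alpha>\<in>UNIV. (norm (x \<alpha> 0 - center x 0))\<^sup>2 + (norm (v \<alpha> 0 - center v 0))\<^sup>2)
             * exp (- (2 * \<epsilon> / 3) * t))
    \<and> (\<forall>t\<ge>0.
         (\<Sum>\<alpha>\<in>UNIV. \<bar>T \<alpha> t - T_inf v T t\<bar>\<^sup>2)
         \<le> (\<Sum>\<alpha>\<in>UNIV. \<bar>T \<alpha> 0 - T_inf v T 0\<bar>\<^sup>2) * exp (- A1 \<kappa>1 \<kappa>2 \<phi> \<zeta> \<epsilon>0 x v T * t)
            + A2 \<kappa>1 \<kappa>2 \<phi> \<zeta> \<epsilon>0 x v T / (A1 \<kappa>1 \<kappa>2 \<phi> \<zeta> \<epsilon>0 x v T - 2/3 * \<epsilon>)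
              * (exp (- (2 * \<epsilon> / 3) * t) - exp (- A1 \<kappa>1 \<kappa>2 \<phi> \<zeta> \<epsilon>0 x v T * t)))"
proof -
  have L: "0 < T_m x v T - \<epsilon>0"
  proof -
    have "1 * \<epsilon>0 < \<delta> * \<epsilon>0" using assms(12,13) by (intro mult_strict_right_mono) auto
    then show ?thesis using assms(15) by linarith
  qed
  have lam: "0 < lam" using assms(1,11,13) by (simp add: assms(22))
  interpret flocking_regime \<kappa>1 \<kappa>2 \<phi> \<zeta> x v T \<delta> \<epsilon>0 \<epsilon>
  proof unfold_locales
    have "(\<epsilon> + \<epsilon> * gam) / lam < \<phi> (3 * sqrt 2 * \<epsilon>0)" using assms(24) by simp
    then have "\<epsilon> + \<epsilon> * gam < lam * \<phi> (3 * sqrt 2 * \<epsilon>0)"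
      using lam by (simp add: pos_divide_less_eq mult.commute)
    moreover have "\<epsilon> * (2 + 3 * (\<kappa>1 * \<phi> 0)\<^sup>2 / (T_m x v T - \<epsilon>0)\<^sup>2) = \<epsilon> + \<epsilon> * gam"
      by (simp add: assms(23) algebra_simps)
    ultimately show "\<epsilon> * (2 + 3 * (\<kappa>1 * \<phi> 0)\<^sup>2 / (T_m x v T - \<epsilon>0)\<^sup>2)
        \<le> \<kappa>1 / (2 * (T_M v T + \<epsilon>0)) * \<phi> (3 * sqrt 2 * \<epsilon>0)"
      unfolding assms(22) by linarith
    show "2 * (T_M v T + \<epsilon>0) * \<phi> 0 / ((\<delta> - 1) * (T_m x v T - \<epsilon>0)) \<le> \<phi> (3 * sqrt 2 * \<epsilon>0)"
      using assms(24) by simp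
  qed (use assms(1-20) in auto)
  have a1: "a\<^sub>1 \<noteq> 2 * \<epsilon> / 3" using assms(21) by simp
  have conf: "confined t" if "0 \<le> t" for t
    using confined_always[OF assms(16,17) assms(18) assms(14) a1 that] .
  have bounds: "\<bar>dT \<alpha> t\<bar> \<le> \<epsilon>0 \<and> L \<le> T \<alpha> t \<and> T \<alpha> t \<le> U" if "0 \<le> t" for \<alpha> t
    using temperature_bounds[OF that] conf[OF that] by (simp add: confined_def)
  have flock: "(\<Sum>\<alpha>\<in>UNIV. (norm (dx \<alpha> t))\<^sup>2 + (norm (dv \<alpha> t))\<^sup>2)
      \<le> 4 * (\<Sum>\<alpha>\<in>UNIV. (norm (dx \<alpha> 0))\<^sup>2 + (norm (dv \<alpha> 0))\<^sup>2) * exp (- (2 * \<epsilon> / 3) * t)"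
    if "0 \<le> t" for t
  proof -
    have "\<X> t + \<V> t \<le> 3 * (\<X> 0 + \<V> 0) * exp (- (2 * \<epsilon> / 3) * t)"
      by (rule flocking_decay[OF that conf])
    also have "\<dots> \<le> 4 * (\<X> 0 + \<V> 0) * exp (- (2 * \<epsilon> / 3) * t)"
      by (intro mult_right_mono) (auto intro!: add_nonneg_nonneg sum_nonneg)
    finally show ?thesis by (simp only: sum.distrib)
  qed
  have temp: "(\<Sum>\<alpha>\<in>UNIV. \<bar>dT \<alpha> t\<bar>\<^sup>2) \<le> (\<Sum>\<alpha>\<in>UNIV. \<bar>dT \<alpha> 0\<bar>\<^sup>2) * exp (- a\<^sub>1 * t)
      + a\<^sub>2 / (a\<^sub>1 - 2/3 * \<epsilon>) * (exp (- (2 * \<epsilon> / 3) * t) - exp (- a\<^sub>1 * t))"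
    if "0 \<le> t" for t
    using temperature_decay[OF that conf a1] by simp
  have "(SUP t\<in>{0..}. ereal \<bar>T \<alpha> t - T_inf v T t\<bar>) \<le> ereal \<epsilon>0" for \<alpha>
    using bounds[of _ \<alpha>] by (intro SUP_least) (simp add: dT_def)
  moreover have "\<forall>\<alpha>. \<forall>t\<ge>0. T_m x v T - \<epsilon>0 \<le> T \<alpha> t \<and> T \<alpha> t \<le> T_M v T + \<epsilon>0"
    using bounds unfolding L_def U_def by blast
  ultimately show ?thesis
    using L flock temp unfolding dx_def dv_def dT_def by blast
qed

end
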